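(* Let $M$ be a statistical transformation model on $\mathcal{X}$ with acting group $G$. Let $\Phi:TM\to L^2(\mathcal{X})$ be $[\Phi(p,v)](x)=\sqrt{p(x)}\exp\left(\frac{i\,v(x)}{2}\right)$, let $\pi_{\mathbb{P}}:L^2(\mathcal{X})\setminus\{0\}\to\mathbb{P}L^2(\mathcal{X})$ be the projection onto the complex projective space, and let $N=\operatorname{Im}(\pi_{\mathbb{P}}\circ\Phi)\subseteq\mathbb{P}L^2(\mathcal{X})$. Let $G$ act on $\mathbb{P}L^2(\mathcal{X})$ by $g[q(x)]=[q(g^{-1}x)]$ and on $TM$ by $g(p,v)=(gp,g_*v)$. Then $N$ is invariant under the action of $G$, and the map $\pi_{\mathbb{P}}\circ\Phi$ is $G$-equivariant.
   Context: Statistical transformation model: $\mathcal{X}$ is a Riemannian manifold with an action of a Lie group $G$ under which the Riemannian (geometric) measure $\mu$ is invariant. $M$ is a statistical model on $\mathcal{X}$, i.e. a finite-dimensional manifold of probability measures on $\mathcal{X}$, injectively parametrized, whose tangent vectors inject into functions on $\mathcal{X}$ by pointwise differentiation of densities. All measures in $M$ are absolutely continuous with respect to $\mu$ and are identified with their densities $p$. $M$ is closed under the action $(gP)(A)=P(g^{-1}A)$ (measurable $A\subseteq\mathcal{X}$), and $G$ acts transitively on $M$. By invariance of $\mu$, in terms of densities $(gp)(x)=p(g^{-1}x)$. Each $g\in G$ is regarded as a diffeomorphism of $M$, and $g_*v\in T_{gp}M$ is the pushforward of $v\in T_pM$. Tangent vectors as functions: $v\in T_pM$ is identified with the function $v:\mathcal{X}\to\mathbb{R}$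 given by $p(x)v(x)=\frac{d}{dt}\big|_{t=0}p_t(x)$, where $p_t$ is a curve in $M$ with $p_0=p$, $\dot p_0=v$ (values of $v$ where $p$ vanishes do not affect $\Phi$). $L^2(\mathcal{X})$ is the Hilbert space of complex-valued square-integrable functions with respect to $\mu$. *)

theory Defs
  imports
    "HOL-Probability.Probability"
    "HOL-Algebra.Group_Action"
    "Jordan_Normal_Form.Determinant"
begin

section \<open>Smooth manifolds\<close>

text \<open>
  The coordinate space of dimension \<open>n\<close> is the product of \<open>n\<close> real lines, i.e. the extensional
  functions \<open>{..<n} \<rightarrow>\<^sub>E UNIV\<close>. In this form \<open>n\<close> may vary (and be \<open>0\<close>), and the space also
  carries the product Lebesgue measure \<open>Pi\<^sub>M {..<n} (\<lambda>_. lborel)\<close>.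
\<close>

definition coord_space :: "nat \<Rightarrow> (nat \<Rightarrow> real) topology" where
  "coord_space n = product_topology (\<lambda>_. euclideanreal) {..<n}"

definition partial :: "nat \<Rightarrow> ((nat \<Rightarrow> real) \<Rightarrow> real) \<Rightarrow> (nat \<Rightarrow> real) \<Rightarrow> real" where
  "partial i f x = deriv (\<lambda>t. f (x(i := t))) (x i)"

primrec Ck_on :: "nat \<Rightarrow> nat \<Rightarrow> (nat \<Rightarrow> real) set \<Rightarrow> ((nat \<Rightarrow> real) \<Rightarrow> real) \<Rightarrow> bool" where
  "Ck_on n 0 W f \<longleftrightarrow> continuous_map (subtopology (coord_space n) W) euclideanreal f"
| "Ck_on n (Suc k) W f \<longleftrightarrow>
     continuous_map (subtopology (coord_space n) W) euclideanreal f \<and>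
     (\<forall>i<n. (\<forall>x\<in>W. (\<lambda>t. f (x(i := t))) differentiable at (x i)) \<and> Ck_on n k W (partial i f))"

definition smooth_on :: "nat \<Rightarrow> (nat \<Rightarrow> real) set \<Rightarrow> ((nat \<Rightarrow> real) \<Rightarrow> real) \<Rightarrow> bool" where
  "smooth_on n W f \<longleftrightarrow> (\<forall>k. Ck_on n k W f)"

text \<open>The atlas is any atlas of the smooth structure; it need not be maximal.\<close>

record 'a mfd =
  mtop :: "'a topology"
  mdim :: nat
  atlas :: "('a set \<times> ('a \<Rightarrow> nat \<Rightarrow> real)) set"

abbreviation points :: "('a, 'z) mfd_scheme \<Rightarrow> 'a set" where
  "points M \<equiv> topspace (mtop M)"

definition smooth_manifold :: "'a mfd \<Rightarrow> bool" where
  "smooth_manifold M \<longleftrightarrow>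
     Hausdorff_space (mtop M) \<and> second_countable (mtop M) \<and>
     (\<Union>(U, \<phi>)\<in>atlas M. U) = points M \<and>
     (\<forall>(U, \<phi>)\<in>atlas M.
        openin (mtop M) U \<and> openin (coord_space (mdim M)) (\<phi> ` U) \<and>
        homeomorphic_map (subtopology (mtop M) U) (subtopology (coord_space (mdim M)) (\<phi> ` U)) \<phi>) \<and>
     (\<forall>(U, \<phi>)\<in>atlas M. \<forall>(V, \<psi>)\<in>atlas M. \<forall>i<mdim M.
        smooth_on (mdim M) (\<phi> ` (U \<inter> V)) (\<lambda>y. \<psi> (the_inv_into U \<phi> y) i))"

definition smooth_map :: "'a mfd \<Rightarrow> 'b mfd \<Rightarrow> ('a \<Rightarrow> 'b) \<Rightarrow> bool" where
  "smooth_map M N f \<longleftrightarrow>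
     continuous_map (mtop M) (mtop N) f \<and>
     (\<forall>(U, \<phi>)\<in>atlas M. \<forall>(V, \<psi>)\<in>atlas N. \<forall>i<mdim N.
        smooth_on (mdim M) (\<phi> ` (U \<inter> f -` V)) (\<lambda>y. \<psi> (f (the_inv_into U \<phi> y)) i))"

definition diffeomorphism :: "'a mfd \<Rightarrow> 'b mfd \<Rightarrow> ('a \<Rightarrow> 'b) \<Rightarrow> bool" where
  "diffeomorphism M N f \<longleftrightarrow>
     bij_betw f (points M) (points N) \<and> smooth_map M N f \<and>
     smooth_map N M (the_inv_into (points M) f)"

definition prod_mfd :: "'a mfd \<Rightarrow> 'b mfd \<Rightarrow> ('a \<times> 'b) mfd" where
  "prod_mfd M N =
     \<lparr>mtop = prod_topology (mtop M) (mtop N),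
      mdim = mdim M + mdim N,
      atlas = {(U \<times> V, \<lambda>(a, b). \<lambda>i\<in>{..<mdim M + mdim N}. if i < mdim M then \<phi> a i else \<psi> b (i - mdim M))
               | U \<phi> V \<psi>. (U, \<phi>) \<in> atlas M \<and> (V, \<psi>) \<in> atlas N}\<rparr>"

section \<open>Tangent vectors\<close>

text \<open>
  A tangent vector at \<open>p\<close> is an equivalence class of smooth curves through \<open>p\<close> with the same velocity
  in charts, so that \<open>c \<in> v\<close> says that \<open>c\<close> is a curve with \<open>c 0 = p\<close> and initial velocity \<open>v\<close>.
  Curves are total functions, but only their values near \<open>0\<close> matter.
\<close>

definition curves :: "'a mfd \<Rightarrow> 'a \<Rightarrow> (real \<Rightarrow> 'a) set" where
  "curves M p = {c. c 0 = p \<and>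
     (\<exists>\<epsilon>>0. \<exists>(U, \<phi>)\<in>atlas M. c ` {-\<epsilon><..<\<epsilon>} \<subseteq> U \<and>
        (\<forall>i<mdim M. \<forall>k. \<forall>t\<in>{-\<epsilon><..<\<epsilon>}. (deriv ^^ k) (\<lambda>s. \<phi> (c s) i) differentiable at t))}"

definition tangent_rel :: "'a mfd \<Rightarrow> 'a \<Rightarrow> ((real \<Rightarrow> 'a) \<times> (real \<Rightarrow> 'a)) set" where
  "tangent_rel M p = {(c, c'). c \<in> curves M p \<and> c' \<in> curves M p \<and>
     (\<forall>(U, \<phi>)\<in>atlas M. p \<in> U \<longrightarrow>
        (\<forall>i<mdim M. deriv (\<lambda>t. \<phi> (c t) i) 0 = deriv (\<lambda>t. \<phi> (c' t) i) 0))}"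

definition tangent_space :: "'a mfd \<Rightarrow> 'a \<Rightarrow> (real \<Rightarrow> 'a) set set" where
  "tangent_space M p = curves M p // tangent_rel M p"

definition tangent_bundle :: "'a mfd \<Rightarrow> ('a \<times> (real \<Rightarrow> 'a) set) set" where
  "tangent_bundle M = (SIGMA p:points M. tangent_space M p)"

definition pushforward :: "'b mfd \<Rightarrow> ('a \<Rightarrow> 'b) \<Rightarrow> 'a \<Rightarrow> (real \<Rightarrow> 'a) set \<Rightarrow> (real \<Rightarrow> 'b) set" where
  "pushforward N f p v = (\<Union>c\<in>v. tangent_rel N (f p) `` {f \<circ> c})"

definition tangent_coord :: "('a \<Rightarrow> nat \<Rightarrow> real) \<Rightarrow> (real \<Rightarrow> 'a) set \<Rightarrow> nat \<Rightarrow> real" where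
  "tangent_coord \<phi> v i = deriv (\<lambda>t. \<phi> ((SOME c. c \<in> v) t) i) 0"

definition coord_vector ::
    "'a mfd \<Rightarrow> 'a set \<Rightarrow> ('a \<Rightarrow> nat \<Rightarrow> real) \<Rightarrow> nat \<Rightarrow> 'a \<Rightarrow> (real \<Rightarrow> 'a) set" where
  "coord_vector M U \<phi> i p = tangent_rel M p `` {\<lambda>t. the_inv_into U \<phi> ((\<phi> p)(i := \<phi> p i + t))}"

section \<open>Riemannian metrics and the Riemannian measure\<close>

type_synonym 'a metric_field = "'a \<Rightarrow> (real \<Rightarrow> 'a) set \<Rightarrow> (real \<Rightarrow> 'a) set \<Rightarrow> real"

definition gram ::
    "'a mfd \<Rightarrow> 'a metric_field \<Rightarrow> 'a set \<Rightarrow> ('a \<Rightarrow> nat \<Rightarrow> real) \<Rightarrow> 'a \<Rightarrow> nat \<Rightarrow> nat \<Rightarrow> real" where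
  "gram X h U \<phi> p i j = h p (coord_vector X U \<phi> i p) (coord_vector X U \<phi> j p)"

text \<open>
  The equation for \<open>h p v w\<close> expresses bilinearity; \<open>tangent_rel X p `` {\<lambda>_. p}\<close> is the zero vector.
\<close>

definition riemannian_metric :: "'a mfd \<Rightarrow> 'a metric_field \<Rightarrow> bool" where
  "riemannian_metric X h \<longleftrightarrow>
     (\<forall>(U, \<phi>)\<in>atlas X.
        (\<forall>i<mdim X. \<forall>j<mdim X.
           smooth_on (mdim X) (\<phi> ` U) (\<lambda>y. gram X h U \<phi> (the_inv_into U \<phi> y) i j)) \<and>
        (\<forall>p\<in>U. \<forall>v\<in>tangent_space X p. \<forall>w\<in>tangent_space X p.
           h p v w = (\<Sum>i<mdim X. \<Sum>j<mdim X.
                        tangent_coord \<phi> v i * tangent_coord \<phi> w j * gram X h U \<phi> p i j))) \<and>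
     (\<forall>p\<in>points X. \<forall>v\<in>tangent_space X p. \<forall>w\<in>tangent_space X p. h p v w = h p w v) \<and>
     (\<forall>p\<in>points X. \<forall>v\<in>tangent_space X p. v \<noteq> tangent_rel X p `` {\<lambda>_. p} \<longrightarrow> h p v v > 0)"

definition borel_of :: "'a topology \<Rightarrow> 'a measure" where
  "borel_of T = sigma (topspace T) {U. openin T U}"

text \<open>
  The Borel measure with \<open>d\<mu> = sqrt (det h\<^sub>i\<^sub>j) dy\<^sub>1 \<dots> dy\<^sub>n\<close> in every chart. As the manifold is
  second countable, this determines \<open>\<mu>\<close>.
\<close>

definition riemannian_measure :: "'a mfd \<Rightarrow> 'a metric_field \<Rightarrow> 'a measure \<Rightarrow> bool" where
  "riemannian_measure X h \<mu> \<longleftrightarrow>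
     sets \<mu> = sets (borel_of (mtop X)) \<and>
     (\<forall>(U, \<phi>)\<in>atlas X. \<forall>A\<in>sets \<mu>. A \<subseteq> U \<longrightarrow>
        emeasure \<mu> A =
          (\<integral>\<^sup>+ y\<in>\<phi> ` A.
             ennreal (sqrt (Determinant.det (Matrix.mat (mdim X) (mdim X)
               (\<lambda>(i, j). gram X h U \<phi> (the_inv_into U \<phi> y) i j))))
           \<partial>(Pi\<^sub>M {..<mdim X} (\<lambda>_. lborel))))"

section \<open>Lie groups\<close>

definition lie_group :: "('g, 'z) monoid_scheme \<Rightarrow> 'g mfd \<Rightarrow> bool" where
  "lie_group G L \<longleftrightarrow>
     group G \<and> smooth_manifold L \<and> points L = carrier G \<and>
     smooth_map (prod_mfd L L) L (\<lambda>(a, b). a \<otimes>\<^bsub>G\<^esub> b) \<and>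
     smooth_map L L (m_inv G)"

definition smooth_action ::
    "('g, 'z) monoid_scheme \<Rightarrow> 'g mfd \<Rightarrow> 'x mfd \<Rightarrow> ('g \<Rightarrow> 'x \<Rightarrow> 'x) \<Rightarrow> bool" where
  "smooth_action G L X act \<longleftrightarrow>
     group_action G (points X) act \<and> smooth_map (prod_mfd L X) X (\<lambda>(g, x). act g x)"

section \<open>Statistical models\<close>

text \<open>
  \<open>dens P\<close> is the density identified with the measure \<open>P\<close>. It is a fixed version, since tangent
  vectors are read off by differentiating densities at each point.
\<close>

definition density_deriv ::
    "('x measure \<Rightarrow> 'x \<Rightarrow> real) \<Rightarrow> (real \<Rightarrow> 'x measure) set \<Rightarrow> 'x \<Rightarrow> real" where
  "density_deriv dens v x = deriv (\<lambda>t. dens ((SOME c. c \<in> v) t) x) 0"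

text \<open>
  The points of the manifold \<open>M\<close> are the measures themselves, so the model is injectively
  parametrized. The last two conditions say that pointwise differentiation of densities is a well
  defined and injective map on each tangent space.
\<close>

definition statistical_model ::
    "'x measure \<Rightarrow> 'x measure mfd \<Rightarrow> ('x measure \<Rightarrow> 'x \<Rightarrow> real) \<Rightarrow> bool" where
  "statistical_model \<mu> M dens \<longleftrightarrow>
     smooth_manifold M \<and>
     (\<forall>P\<in>points M.
        prob_space P \<and>
        dens P \<in> borel_measurable \<mu> \<and> (\<forall>x\<in>space \<mu>. dens P x \<ge> 0) \<and>
        P = density \<mu> (\<lambda>x. ennreal (dens P x)) \<and>
        (\<forall>v\<in>tangent_space M P. \<forall>c\<in>v. \<forall>x\<in>space \<mu>.
           ((\<lambda>t. dens (c t) x) has_real_derivative density_deriv dens v x) (at 0)) \<and>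
        inj_on (\<lambda>v. restrict (density_deriv dens v) (space \<mu>)) (tangent_space M P))"

text \<open>\<open>(g P)(A) = P(g\<^sup>-\<^sup>1 A)\<close>\<close>

definition measure_act :: "'x measure \<Rightarrow> ('g \<Rightarrow> 'x \<Rightarrow> 'x) \<Rightarrow> 'g \<Rightarrow> 'x measure \<Rightarrow> 'x measure" where
  "measure_act \<mu> act g P = distr P \<mu> (act g)"

locale statistical_transformation_model =
  fixes G :: "('g, 'z) monoid_scheme" (structure)
    and L :: "'g mfd"
    and X :: "'x mfd"
    and h :: "'x metric_field"
    and \<mu> :: "'x measure"
    and act :: "'g \<Rightarrow> 'x \<Rightarrow> 'x"
    and M :: "'x measure mfd"
    and dens :: "'x measure \<Rightarrow> 'x \<Rightarrow> real"
  assumes manifold_X: "smooth_manifold X"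
    and metric: "riemannian_metric X h"
    and measure: "riemannian_measure X h \<mu>"
    and lie_group: "lie_group G L"
    and action_X: "smooth_action G L X act"
    and measure_invariant: "\<And>g. g \<in> carrier G \<Longrightarrow> distr \<mu> \<mu> (act g) = \<mu>"
    and model: "statistical_model \<mu> M dens"
    and transitive_M: "transitive_action G (points M) (\<lambda>g. \<lambda>P\<in>points M. measure_act \<mu> act g P)"
    and diffeo_M: "\<And>g. g \<in> carrier G \<Longrightarrow> diffeomorphism M M (measure_act \<mu> act g)"

definition bundle_act ::
    "'x measure \<Rightarrow> ('g \<Rightarrow> 'x \<Rightarrow> 'x) \<Rightarrow> 'x measure mfd \<Rightarrow> 'g \<Rightarrow>
      'x measure \<times> (real \<Rightarrow> 'x measure) set \<Rightarrow> 'x measure \<times> (real \<Rightarrow> 'x measure) set" where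
  "bundle_act \<mu> act M g = (\<lambda>(P, v). (measure_act \<mu> act g P, pushforward M (measure_act \<mu> act g) P v))"

text \<open>
  The function identified with \<open>v \<in> T\<^sub>P M\<close>, i.e. the solution of \<open>p(x) v(x) = d/dt p\<^sub>t(x)\<close>; it is \<open>0\<close>
  where \<open>p\<close> vanishes.
\<close>

definition score ::
    "('x measure \<Rightarrow> 'x \<Rightarrow> real) \<Rightarrow> 'x measure \<Rightarrow> (real \<Rightarrow> 'x measure) set \<Rightarrow> 'x \<Rightarrow> real" where
  "score dens P v x = density_deriv dens v x / dens P x"

section \<open>The Hilbert space of square-integrable functions and its projective space\<close>

definition L2_fun :: "'x measure \<Rightarrow> ('x \<Rightarrow> complex) set" where
  "L2_fun \<mu> = {f \<in> borel_measurable \<mu>. integrable \<mu> (\<lambda>x. (cmod (f x))\<^sup>2)}"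

definition ae_rel :: "'x measure \<Rightarrow> (('x \<Rightarrow> complex) \<times> ('x \<Rightarrow> complex)) set" where
  "ae_rel \<mu> = {(f, f'). f \<in> L2_fun \<mu> \<and> f' \<in> L2_fun \<mu> \<and> (AE x in \<mu>. f x = f' x)}"

definition L2 :: "'x measure \<Rightarrow> ('x \<Rightarrow> complex) set set" where
  "L2 \<mu> = L2_fun \<mu> // ae_rel \<mu>"

definition L2_class :: "'x measure \<Rightarrow> ('x \<Rightarrow> complex) \<Rightarrow> ('x \<Rightarrow> complex) set" where
  "L2_class \<mu> f = ae_rel \<mu> `` {f}"

definition L2_zero :: "'x measure \<Rightarrow> ('x \<Rightarrow> complex) set" where
  "L2_zero \<mu> = L2_class \<mu> (\<lambda>_. 0)"

definition L2_scale :: "'x measure \<Rightarrow> complex \<Rightarrow> ('x \<Rightarrow> complex) set \<Rightarrow> ('x \<Rightarrow> complex) set" where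
  "L2_scale \<mu> a F = (\<Union>f\<in>F. L2_class \<mu> (\<lambda>x. a * f x))"

definition L2_act ::
    "'x measure \<Rightarrow> ('g, 'z) monoid_scheme \<Rightarrow> ('g \<Rightarrow> 'x \<Rightarrow> 'x) \<Rightarrow> 'g \<Rightarrow> ('x \<Rightarrow> complex) set \<Rightarrow>
      ('x \<Rightarrow> complex) set" where
  "L2_act \<mu> G act g F = (\<Union>f\<in>F. L2_class \<mu> (\<lambda>x. f (act (inv\<^bsub>G\<^esub> g) x)))"

definition proj_rel :: "'x measure \<Rightarrow> (('x \<Rightarrow> complex) set \<times> ('x \<Rightarrow> complex) set) set" where
  "proj_rel \<mu> = {(F, F'). F \<in> L2 \<mu> - {L2_zero \<mu>} \<and> F' \<in> L2 \<mu> - {L2_zero \<mu>} \<and>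
     (\<exists>a. a \<noteq> 0 \<and> F' = L2_scale \<mu> a F)}"

definition PL2 :: "'x measure \<Rightarrow> ('x \<Rightarrow> complex) set set set" where
  "PL2 \<mu> = (L2 \<mu> - {L2_zero \<mu>}) // proj_rel \<mu>"

definition proj_class :: "'x measure \<Rightarrow> ('x \<Rightarrow> complex) set \<Rightarrow> ('x \<Rightarrow> complex) set set" where
  "proj_class \<mu> F = proj_rel \<mu> `` {F}"

definition PL2_act ::
    "'x measure \<Rightarrow> ('g, 'z) monoid_scheme \<Rightarrow> ('g \<Rightarrow> 'x \<Rightarrow> 'x) \<Rightarrow> 'g \<Rightarrow> ('x \<Rightarrow> complex) set set \<Rightarrow>
      ('x \<Rightarrow> complex) set set" where
  "PL2_act \<mu> G act g \<xi> = (\<Union>F\<in>\<xi>. proj_class \<mu> (L2_act \<mu> G act g F))"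

definition Phi ::
    "'x measure \<Rightarrow> ('x measure \<Rightarrow> 'x \<Rightarrow> real) \<Rightarrow> 'x measure \<times> (real \<Rightarrow> 'x measure) set \<Rightarrow>
      ('x \<Rightarrow> complex) set" where
  "Phi \<mu> dens = (\<lambda>(P, v). L2_class \<mu>
     (\<lambda>x. complex_of_real (sqrt (dens P x)) * exp (\<i> * complex_of_real (score dens P v x) / 2)))"

definition N_image ::
    "'x measure \<Rightarrow> 'x measure mfd \<Rightarrow> ('x measure \<Rightarrow> 'x \<Rightarrow> real) \<Rightarrow> ('x \<Rightarrow> complex) set set set" where
  "N_image \<mu> M dens = (proj_class \<mu> \<circ> Phi \<mu> dens) ` tangent_bundle M"

text \<open>\<open>Phi\<close> takes values in the nonzero vectors of \<open>L2\<close>, so that \<open>N_image\<close> lies in the projective space.\<close>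

lemma Phi_mem:
  assumes model: "statistical_model \<mu> M dens" and w: "w \<in> tangent_bundle M"
  shows "Phi \<mu> dens w \<in> L2 \<mu> - {L2_zero \<mu>}"
proof -
  obtain P v where wPv: "w = (P, v)" and P: "P \<in> points M" and v: "v \<in> tangent_space M P"
    using w by (auto simp: tangent_bundle_def)
  obtain c where c: "c \<in> curves M P" and vc: "v = tangent_rel M P `` {c}"
    using v by (auto simp: tangent_space_def quotient_def)
  have cv: "c \<in> v" using c vc by (auto simp: tangent_rel_def)
  have mfd: "smooth_manifold M" using model by (simp add: statistical_model_def)
  obtain \<epsilon> where \<epsilon>: "\<epsilon> > 0" and ce: "\<And>t. \<bar>t\<bar> < \<epsilon> \<Longrightarrow> c t \<in> points M"
  proof -
    from c obtain \<epsilon> U \<phi> where e: "\<epsilon> > 0" "(U, \<phi>) \<in> atlas M" "c ` {-\<epsilon><..<\<epsilon>} \<subseteq> U"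
      unfolding curves_def by blast
    have "U \<subseteq> points M"
      using mfd e(2) unfolding smooth_manifold_def by blast
    then have "c t \<in> points M" if "\<bar>t\<bar> < \<epsilon>" for t
      using e(3) that by (auto simp: image_subset_iff abs_less_iff)
    with e(1) that show ?thesis by blast
  qed
  have c0: "c 0 = P" using c by (auto simp: curves_def)
  have mP: "prob_space P" "dens P \<in> borel_measurable \<mu>" "\<And>x. x \<in> space \<mu> \<Longrightarrow> dens P x \<ge> 0"
      "P = density \<mu> (\<lambda>x. ennreal (dens P x))"
    using model P unfolding statistical_model_def by blast+
  have meas: "dens Q \<in> borel_measurable \<mu>" if "Q \<in> points M" for Q
    using model that unfolding statistical_model_def by blast
  have der: "((\<lambda>t. dens (c t) x) has_real_derivative density_deriv dens v x) (at 0)"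
    if "x \<in> space \<mu>" for x
    using model P v cv that unfolding statistical_model_def by blast
  obtain n0 :: nat where n0: "inverse (real (Suc n0)) < \<epsilon>"
    using reals_Archimedean[OF \<epsilon>] by blast
  define r :: "nat \<Rightarrow> real" where "r n = inverse (real (Suc (n + n0)))" for n
  have r: "\<bar>r n\<bar> < \<epsilon>" for n
  proof -
    have "r n \<le> inverse (real (Suc n0))" unfolding r_def by (intro le_imp_inverse_le) auto
    moreover have "r n > 0" by (simp add: r_def)
    ultimately show ?thesis using n0 by linarith
  qed
  have r0: "r \<longlonglongrightarrow> 0"
    unfolding r_def
    using LIMSEQ_ignore_initial_segment[OF LIMSEQ_inverse_real_of_nat, of n0] by simp
  have dmeas: "density_deriv dens v \<in> borel_measurable \<mu>"
  proof (rule borel_measurable_LIMSEQ_real)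
    fix x assume x: "x \<in> space \<mu>"
    have "((\<lambda>t. (dens (c t) x - dens P x) / t) \<longlongrightarrow> density_deriv dens v x) (at 0)"
      using der[OF x] c0 by (simp add: has_field_derivative_iff)
    moreover have "filterlim r (at 0) sequentially"
      using r0 by (auto simp: filterlim_at r_def)
    ultimately show "(\<lambda>n. (dens (c (r n)) x - dens P x) / r n) \<longlonglongrightarrow> density_deriv dens v x"
      by (rule filterlim_compose)
  next
    fix n
    have [measurable]: "dens (c (r n)) \<in> borel_measurable \<mu>" "dens P \<in> borel_measurable \<mu>"
      using meas ce r mP by auto
    show "(\<lambda>x. (dens (c (r n)) x - dens P x) / r n) \<in> borel_measurable \<mu>" by measurable
  qed
  define f where "f x = complex_of_real (sqrt (dens P x)) *
      exp (\<i> * complex_of_real (score dens P v x) / 2)" for x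
  have [measurable]: "dens P \<in> borel_measurable \<mu>" "density_deriv dens v \<in> borel_measurable \<mu>"
    using mP dmeas by auto
  have smeas[measurable]: "score dens P v \<in> borel_measurable \<mu>"
    unfolding score_def by measurable
  have fmeas: "f \<in> borel_measurable \<mu>"
    unfolding f_def by measurable
  have nf: "cmod (f x) = sqrt \<bar>dens P x\<bar>" for x
  proof -
    have "cmod (exp (\<i> * complex_of_real (score dens P v x) / 2)) = 1" by simp
    then show ?thesis by (simp add: f_def norm_mult abs_if real_sqrt_minus del: norm_exp_eq_Re)
  qed
  have one: "(\<integral>\<^sup>+ x. ennreal (dens P x) \<partial>\<mu>) = 1"
  proof -
    have "emeasure P (space P) = 1" by (rule prob_space.emeasure_space_1[OF mP(1)])
    moreover have "space P = space \<mu>" by (subst mP(4)) simp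
    moreover have "emeasure P (space \<mu>) = (\<integral>\<^sup>+ x. ennreal (dens P x) \<partial>\<mu>)"
      by (subst mP(4)) (simp add: emeasure_density cong: nn_integral_cong)
    ultimately show ?thesis by simp
  qed
  have int: "integrable \<mu> (dens P)"
    by (rule integrableI_nn_integral_finite[where x = 1]) (use mP one in auto)
  have "integrable \<mu> (\<lambda>x. (cmod (f x))\<^sup>2)"
    using int by (simp add: nf)
  then have fL: "f \<in> L2_fun \<mu>" using fmeas by (simp add: L2_fun_def)
  have ff: "f \<in> L2_class \<mu> f" using fL by (simp add: L2_class_def ae_rel_def)
  have "f \<notin> L2_zero \<mu>"
  proof
    assume "f \<in> L2_zero \<mu>"
    then have "AE x in \<mu>. f x = 0" by (auto simp: L2_zero_def L2_class_def ae_rel_def elim: eventually_mono)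
    then have "AE x in \<mu>. ennreal (dens P x) = 0"
    proof (rule AE_mp, intro AE_I2 impI)
      fix x assume "f x = 0"
      then have "dens P x = 0" using nf[of x] by simp
      then show "ennreal (dens P x) = 0" by simp
    qed
    then have "(\<integral>\<^sup>+ x. ennreal (dens P x) \<partial>\<mu>) = (\<integral>\<^sup>+ x. 0 \<partial>\<mu>)" by (rule nn_integral_cong_AE)
    with one show False by simp
  qed
  moreover have "Phi \<mu> dens w = L2_class \<mu> f" by (simp add: Phi_def wPv f_def[abs_def])
  ultimately show ?thesis
    using ff fL by (auto simp: L2_def L2_class_def quotient_def)
qed

lemma N_image_subset:
  assumes "statistical_model \<mu> M dens"
  shows "N_image \<mu> M dens \<subseteq> PL2 \<mu>"
  using Phi_mem[OF assms] by (auto simp: N_image_def PL2_def proj_class_def intro!: quotientI)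

end

theory Submission
  imports Defs
begin

text \<open>
  Let \<open>w = (P, v)\<close> be a tangent vector, represented by a curve \<open>c\<close> through \<open>P\<close>. Since \<open>\<mu>\<close> is
  invariant, \<open>x \<mapsto> p(g\<^sup>-\<^sup>1 x)\<close> is a density of \<open>g P\<close> (\<open>dens_measure_act\<close>). Differentiating this along
  the curve gives \<open>(g\<^sub>* v)(x) = v(g\<^sup>-\<^sup>1 x)\<close> (\<open>density_deriv_pushforward\<close>). Substituting both into
  the formula for \<open>\<Phi>\<close> gives \<open>\<Phi>(g w) = g \<Phi>(w)\<close> already in \<open>L\<^sup>2\<close> (\<open>Phi_equivariant\<close>). The action of
  \<open>G\<close> on \<open>L\<^sup>2\<close> is linear and keeps nonzero vectors nonzero, so it descends to the projective space
  (\<open>PL2_act_class\<close>) and \<open>\<pi> \<circ> \<Phi>\<close> is equivariant. Invariance of its image follows, because \<open>G\<close> maps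
  the tangent bundle to itself.

  Two points need care. The densities are fixed functions, so the identities above hold only almost
  everywhere, with an exceptional null set for each measure; along a curve these would be
  uncountably many. Pointwise differentiability of the densities reduces the derivative to a
  sequence of difference quotients, hence to countably many null sets.

  Moreover, that \<open>g\<^sub>* v\<close> is a tangent vector at all, represented by \<open>g \<circ> c\<close>, amounts to the chain rule:
  a smooth map sends smooth curves to smooth curves, and curves of equal velocity to curves of
  equal velocity (\<open>smooth_map_curve\<close>, \<open>smooth_map_tangent_rel\<close>). It is derived from
  continuity of the partial derivatives in charts (\<open>chain_rule_curve\<close>) and iterated for derivatives of
  all orders (\<open>times_differentiable_compose\<close>).
\<close>

section \<open>The chain rule in coordinates\<close>

lemma topspace_coord_space: "topspace (coord_space n) = extensional {..<n}"
  by (simp add: coord_space_def PiE_def)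

lemma open_coord_space_box:
  assumes W: "openin (coord_space n) W" and x: "x \<in> W"
  obtains d where "d > 0"
    "\<And>y. y \<in> extensional {..<n} \<Longrightarrow> (\<And>i. i < n \<Longrightarrow> \<bar>y i - x i\<bar> < d) \<Longrightarrow> y \<in> W"
proof -
  obtain U where U: "\<forall>i\<in>{..<n}. openin euclideanreal (U i)" "x \<in> Pi\<^sub>E {..<n} U"
      "Pi\<^sub>E {..<n} U \<subseteq> W"
    using W x unfolding coord_space_def openin_product_topology_alt by meson
  have "\<forall>i\<in>{..<n}. \<exists>e>0. \<forall>z. \<bar>z - x i\<bar> < e \<longrightarrow> z \<in> U i"
  proof
    fix i assume i: "i \<in> {..<n}"
    have "open (U i)" "x i \<in> U i" using U i by (auto simp: PiE_iff)
    then show "\<exists>e>0. \<forall>z. \<bar>z - x i\<bar> < e \<longrightarrow> z \<in> U i"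
      by (auto simp: open_dist dist_real_def)
  qed
  then obtain e where e: "\<And>i. i < n \<Longrightarrow> e i > 0"
      "\<And>i z. i < n \<Longrightarrow> \<bar>z - x i\<bar> < e i \<Longrightarrow> z \<in> U i"
    unfolding bchoice_iff by (metis lessThan_iff)
  define d where "d = Min (insert 1 (e ` {..<n}))"
  have "d > 0" using e(1) by (auto simp: d_def)
  moreover have "y \<in> W" if y: "y \<in> extensional {..<n}" "\<And>i. i < n \<Longrightarrow> \<bar>y i - x i\<bar> < d" for y
  proof -
    have "d \<le> e i" if "i < n" for i using that by (auto simp: d_def intro!: Min_le)
    then have "y i \<in> U i" if "i < n" for i using y(2)[OF that] e(2)[OF that] that by fastforce
    then have "y \<in> Pi\<^sub>E {..<n} U" using y(1) by (auto simp: PiE_iff)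
    then show ?thesis using U(3) by blast
  qed
  ultimately show ?thesis using that by blast
qed

lemma eventually_in_open_coord_space:
  assumes W: "openin (coord_space n) W" and x: "x \<in> W"
    and ext: "\<forall>\<^sub>F s in A. \<gamma> s \<in> extensional {..<n}"
    and lim: "\<And>i. i < n \<Longrightarrow> ((\<lambda>s. \<gamma> s i) \<longlongrightarrow> x i) A"
  shows "\<forall>\<^sub>F s in A. \<gamma> s \<in> W"
proof -
  obtain d where d: "d > 0"
    "\<And>y. y \<in> extensional {..<n} \<Longrightarrow> (\<And>i. i < n \<Longrightarrow> \<bar>y i - x i\<bar> < d) \<Longrightarrow> y \<in> W"
    using open_coord_space_box[OF W x] by metis
  have "\<forall>\<^sub>F s in A. \<forall>i\<in>{..<n}. \<bar>\<gamma> s i - x i\<bar> < d"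
    by (rule eventually_ball_finite) (use tendstoD[OF lim d(1)] in \<open>auto simp: dist_real_def\<close>)
  with ext show ?thesis by eventually_elim (use d(2) in auto)
qed

lemma smooth_on_continuous:
  "smooth_on n W f \<Longrightarrow> continuous_map (subtopology (coord_space n) W) euclideanreal f"
  unfolding smooth_on_def by (metis Ck_on.simps(1))

lemma smooth_on_differentiable:
  "smooth_on n W f \<Longrightarrow> i < n \<Longrightarrow> x \<in> W \<Longrightarrow> (\<lambda>t. f (x(i := t))) differentiable at (x i)"
  unfolding smooth_on_def by (metis Ck_on.simps(2))

lemma smooth_on_partial: "smooth_on n W f \<Longrightarrow> i < n \<Longrightarrow> smooth_on n W (partial i f)"
  unfolding smooth_on_def by (metis Ck_on.simps(2))

lemma smooth_on_has_partial:
  assumes "smooth_on n W f" "i < n" "x(i := z) \<in> W"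
  shows "((\<lambda>t. f (x(i := t))) has_real_derivative partial i f (x(i := z))) (at z)"
proof -
  have "(\<lambda>t. f (x(i := t))) differentiable at z"
    using smooth_on_differentiable[OF assms] by simp
  then show ?thesis
    by (simp add: partial_def DERIV_deriv_iff_real_differentiable)
qed

text \<open>
  The increment of \<open>F\<close> along the curve is split into increments in one coordinate at a time. By the
  mean value inequality each of these is the increment of the coordinate times a factor tending to
  the partial derivative, because the partial derivatives are continuous.
\<close>

lemma chain_rule_curve:
  assumes W: "openin (coord_space n) W" and F: "smooth_on n W F"
    and \<gamma>W: "\<forall>\<^sub>F s in nhds t. \<gamma> s \<in> W"
    and \<gamma>': "\<And>i. i < n \<Longrightarrow> ((\<lambda>s. \<gamma> s i) has_real_derivative \<gamma>' i) (at t)"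
  shows "((\<lambda>s. F (\<gamma> s)) has_real_derivative (\<Sum>i<n. partial i F (\<gamma> t) * \<gamma>' i)) (at t)"
proof -
  have tW: "\<gamma> t \<in> W" using \<gamma>W by (rule eventually_nhds_x_imp_x)
  have WE: "W \<subseteq> extensional {..<n}"
    using openin_subset[OF W] by (simp add: topspace_coord_space)
  define \<eta> where "\<eta> i s = (\<lambda>j. if j < i then \<gamma> s j else \<gamma> t j)" for i s
  have \<eta>_Suc: "\<eta> (Suc i) s = (\<eta> i s)(i := \<gamma> s i)" for i s
    by (auto simp: \<eta>_def fun_eq_iff less_Suc_eq)
  have \<eta>_upd: "(\<eta> i s)(i := \<gamma> t i) = \<eta> i s" for i s
    by (auto simp: \<eta>_def fun_eq_iff)
  \<comment> \<open>If the \<open>i\<close>-th coordinate does not move, any factor will do; the limit itself keeps \<open>q\<close> convergent.\<close>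
  define q where "q i s = (if \<gamma> s i = \<gamma> t i then partial i F (\<gamma> t)
      else (F (\<eta> (Suc i) s) - F (\<eta> i s)) / (\<gamma> s i - \<gamma> t i))" for i s
  have near: "\<forall>\<^sub>F s in at t. \<bar>\<gamma> s j - \<gamma> t j\<bar> < d" if "j < n" "d > 0" for j d
  proof -
    have "isCont (\<lambda>s. \<gamma> s j) t" using \<gamma>'[OF that(1)] by (rule DERIV_isCont)
    then show ?thesis
      using tendstoD[OF _ that(2), of "\<lambda>s. \<gamma> s j" "\<gamma> t j" "at t"]
      by (simp add: isCont_def dist_real_def)
  qed
  have atW: "\<forall>\<^sub>F s in at t. \<gamma> s \<in> W" using \<gamma>W by (rule filter_leD[OF at_within_le_nhds])
  have qlim: "(q i \<longlongrightarrow> partial i F (\<gamma> t)) (at t)" if i: "i < n" for i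
  proof (rule tendstoI)
    fix e :: real assume e: "e > 0"
    define D where "D = partial i F (\<gamma> t)"
    \<comment> \<open>In a box around \<open>\<gamma> t\<close> inside \<open>W'\<close> the partial derivative varies by less than \<open>e / 2\<close>, and the
      segment on which the mean value inequality is used stays in that box.\<close>
    define W' where "W' = {y \<in> W. \<bar>partial i F y - D\<bar> < e / 2}"
    have "openin (subtopology (coord_space n) W)
        {y \<in> topspace (subtopology (coord_space n) W). partial i F y \<in> ball D (e / 2)}"
      by (rule openin_continuous_map_preimage[OF smooth_on_continuous[OF smooth_on_partial[OF F i]]])
        simp
    moreover have "{y \<in> topspace (subtopology (coord_space n) W). partial i F y \<in> ball D (e / 2)} = W'"
      using WE by (auto simp: W'_def topspace_coord_space dist_real_def abs_minus_commute)
    ultimately have W': "openin (coord_space n) W'"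
      using W openin_trans_full by metis
    have "\<gamma> t \<in> W'" using tW e by (simp add: W'_def D_def)
    then obtain d where d: "d > 0"
      "\<And>y. y \<in> extensional {..<n} \<Longrightarrow> (\<And>j. j < n \<Longrightarrow> \<bar>y j - \<gamma> t j\<bar> < d) \<Longrightarrow> y \<in> W'"
      using open_coord_space_box[OF W'] by metis
    have "\<forall>\<^sub>F s in at t. \<forall>j\<in>{..<n}. \<bar>\<gamma> s j - \<gamma> t j\<bar> < d"
      by (rule eventually_ball_finite) (use near d(1) in auto)
    with atW show "\<forall>\<^sub>F s in at t. dist (q i s) (partial i F (\<gamma> t)) < e"
    proof eventually_elim
      case (elim s)
      show ?case
      proof (cases "\<gamma> s i = \<gamma> t i")
        case True
        then show ?thesis using e by (simp add: q_def)
      next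
        case False
        let ?B = "ball (\<gamma> t i) d"
        have seg: "(\<eta> i s)(i := z) \<in> W'" if "z \<in> ?B" for z
        proof (rule d(2))
          show "(\<eta> i s)(i := z) \<in> extensional {..<n}"
            using elim(1) tW WE i by (auto simp: \<eta>_def extensional_def subset_iff)
          show "\<bar>((\<eta> i s)(i := z)) j - \<gamma> t j\<bar> < d" if "j < n" for j
            using that \<open>z \<in> ?B\<close> elim(2) d(1) by (auto simp: \<eta>_def dist_real_def)
        qed
        let ?k = "\<lambda>z. F ((\<eta> i s)(i := z)) - D * z"
        have "norm (?k (\<gamma> s i) - ?k (\<gamma> t i)) \<le> e / 2 * norm (\<gamma> s i - \<gamma> t i)"
        proof (rule field_differentiable_bound[where S = ?B
              and f' = "\<lambda>z. partial i F ((\<eta> i s)(i := z)) - D"])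
          fix z assume z: "z \<in> ?B"
          show "(?k has_field_derivative partial i F ((\<eta> i s)(i := z)) - D) (at z within ?B)"
          proof (rule DERIV_subset[OF DERIV_diff])
            show "((\<lambda>z. F ((\<eta> i s)(i := z))) has_real_derivative partial i F ((\<eta> i s)(i := z))) (at z)"
              using seg[OF z] by (intro smooth_on_has_partial[OF F i]) (simp add: W'_def)
            show "((\<lambda>z. D * z) has_real_derivative D) (at z)"
              by (rule DERIV_cmult_Id)
          qed simp
          show "norm (partial i F ((\<eta> i s)(i := z)) - D) \<le> e / 2"
            using seg[OF z] by (simp add: W'_def)
        qed (use elim(2) i d(1) in \<open>auto simp: dist_real_def abs_minus_commute\<close>)
        then have *: "\<bar>F (\<eta> (Suc i) s) - F (\<eta> i s) - D * (\<gamma> s i - \<gamma> t i)\<bar> \<le> e / 2 * \<bar>\<gamma> s i - \<gamma> t i\<bar>"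
          by (simp add: \<eta>_Suc \<eta>_upd algebra_simps)
        have "q i s - D = (F (\<eta> (Suc i) s) - F (\<eta> i s) - D * (\<gamma> s i - \<gamma> t i)) / (\<gamma> s i - \<gamma> t i)"
          using False by (simp add: q_def field_simps)
        then have "\<bar>q i s - D\<bar> \<le> e / 2"
          using * False by (simp add: abs_divide pos_divide_le_eq)
        then show ?thesis using e by (simp add: D_def dist_real_def)
      qed
    qed
  qed
  have "((\<lambda>s. \<Sum>i<n. q i s * ((\<gamma> s i - \<gamma> t i) / (s - t))) \<longlongrightarrow>
      (\<Sum>i<n. partial i F (\<gamma> t) * \<gamma>' i)) (at t)"
    using \<gamma>' by (intro tendsto_sum tendsto_mult qlim) (auto simp: has_field_derivative_iff)
  moreover have "\<forall>\<^sub>F s in at t. (\<Sum>i<n. q i s * ((\<gamma> s i - \<gamma> t i) / (s - t))) = (F (\<gamma> s) - F (\<gamma> t)) / (s - t)"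
    using atW
  proof eventually_elim
    case (elim s)
    have *: "q i s * (\<gamma> s i - \<gamma> t i) = F (\<eta> (Suc i) s) - F (\<eta> i s)" for i
      by (cases "\<gamma> s i = \<gamma> t i") (simp_all add: q_def \<eta>_Suc \<eta>_upd)
    have "\<eta> n s = \<gamma> s" "\<eta> 0 s = \<gamma> t"
      using subsetD[OF WE elim] subsetD[OF WE tW] by (auto simp: \<eta>_def fun_eq_iff extensional_def)
    moreover have "(\<Sum>i<n. q i s * ((\<gamma> s i - \<gamma> t i) / (s - t))) =
        (\<Sum>i<n. F (\<eta> (Suc i) s) - F (\<eta> i s)) / (s - t)"
      by (simp only: sum_divide_distrib * [symmetric] times_divide_eq_right)
    moreover have "(\<Sum>i<n. F (\<eta> (Suc i) s) - F (\<eta> i s)) = F (\<eta> n s) - F (\<eta> 0 s)"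
      by (rule sum_lessThan_telescope)
    ultimately show ?case by (simp only:)
  qed
  ultimately show ?thesis
    unfolding has_field_derivative_iff by (rule Lim_transform_eventually)
qed

section \<open>Smooth functions of one variable\<close>

text \<open>
  Peeling off the first derivative, rather than the last one, lets the Leibniz and chain rules be
  iterated by induction on the order.
\<close>

primrec times_differentiable :: "nat \<Rightarrow> real set \<Rightarrow> (real \<Rightarrow> real) \<Rightarrow> bool" where
  "times_differentiable 0 I f \<longleftrightarrow> True"
| "times_differentiable (Suc k) I f \<longleftrightarrow>
     (\<forall>t\<in>I. f differentiable at t) \<and> times_differentiable k I (deriv f)"

lemma times_differentiable_iff:
  "times_differentiable k I f \<longleftrightarrow> (\<forall>j<k. \<forall>t\<in>I. (deriv ^^ j) f differentiable at t)"
proof (induction k arbitrary: f)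
  case (Suc k)
  show ?case
    by (simp add: Suc All_less_Suc2 funpow_swap1)
qed simp

lemma times_differentiable_Suc_imp: "times_differentiable (Suc k) I f \<Longrightarrow> times_differentiable k I f"
  unfolding times_differentiable_iff by simp

lemma times_differentiable_subset:
  "times_differentiable k I f \<Longrightarrow> J \<subseteq> I \<Longrightarrow> times_differentiable k J f"
  unfolding times_differentiable_iff by blast

lemma times_differentiable_cong:
  assumes "open I" "\<And>t. t \<in> I \<Longrightarrow> f t = g t" "times_differentiable k I f"
  shows "times_differentiable k I g"
  using assms(2,3)
proof (induction k arbitrary: f g)
  case (Suc k)
  have ev: "\<forall>\<^sub>F s in nhds t. f s = g s" if "t \<in> I" for t
    using eventually_nhds_in_open[OF assms(1) that] by eventually_elim (rule Suc.prems)
  have "g differentiable at t" if t: "t \<in> I" for t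
  proof -
    have "(f has_real_derivative deriv f t) (at t)"
      using Suc.prems(2) t by (simp add: DERIV_deriv_iff_real_differentiable)
    then show ?thesis
      using DERIV_cong_ev[OF refl ev[OF t] refl] real_differentiable_def by blast
  qed
  moreover have "times_differentiable k I (deriv g)"
    by (rule Suc.IH[where f = "deriv f"]) (use Suc.prems(2) ev in \<open>auto intro: deriv_cong_ev\<close>)
  ultimately show ?case by simp
qed simp

lemma times_differentiable_add:
  assumes "open I" "times_differentiable k I f" "times_differentiable k I g"
  shows "times_differentiable k I (\<lambda>t. f t + g t)"
  using assms(2,3)
proof (induction k arbitrary: f g)
  case (Suc k)
  have d: "((\<lambda>t. f t + g t) has_real_derivative deriv f t + deriv g t) (at t)" if "t \<in> I" for t
    using Suc.prems that by (intro DERIV_add) (auto simp: DERIV_deriv_iff_real_differentiable)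
  have "times_differentiable k I (\<lambda>t. deriv f t + deriv g t)"
    using Suc.prems by (intro Suc.IH) auto
  then have "times_differentiable k I (deriv (\<lambda>t. f t + g t))"
    by (rule times_differentiable_cong[OF assms(1), rotated]) (use d DERIV_imp_deriv in force)
  then show ?case using d real_differentiable_def by auto
qed simp

lemma times_differentiable_sum:
  assumes "open I" "\<And>i. i < (n::nat) \<Longrightarrow> times_differentiable k I (f i)"
  shows "times_differentiable k I (\<lambda>t. \<Sum>i<n. f i t)"
  using assms(2)
proof (induction n)
  case 0
  have "(deriv ^^ j) (\<lambda>_::real. 0::real) = (\<lambda>_. 0)" for j by (induction j) auto
  then show ?case by (simp add: times_differentiable_iff)
next
  case (Suc n)
  then show ?case by (simp add: times_differentiable_add[OF assms(1)])
qed

lemma times_differentiable_mult: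
  assumes "open I" "times_differentiable k I f" "times_differentiable k I g"
  shows "times_differentiable k I (\<lambda>t. f t * g t)"
  using assms(2,3)
proof (induction k arbitrary: f g)
  case (Suc k)
  have d: "((\<lambda>t. f t * g t) has_real_derivative deriv f t * g t + f t * deriv g t) (at t)"
    if "t \<in> I" for t
  proof -
    have "(f has_real_derivative deriv f t) (at t)" "(g has_real_derivative deriv g t) (at t)"
      using Suc.prems that by (auto simp: DERIV_deriv_iff_real_differentiable)
    from DERIV_mult[OF this] show ?thesis by (simp add: algebra_simps)
  qed
  have "times_differentiable k I (\<lambda>t. deriv f t * g t + f t * deriv g t)"
    using Suc.prems Suc.prems[THEN times_differentiable_Suc_imp]
    by (intro times_differentiable_add[OF assms(1)] Suc.IH) auto
  then have "times_differentiable k I (deriv (\<lambda>t. f t * g t))"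
    by (rule times_differentiable_cong[OF assms(1), rotated]) (use d DERIV_imp_deriv in force)
  then show ?case using d real_differentiable_def by auto
qed simp

text \<open>
  Induction for all smooth \<open>F\<close> at once: by the chain rule the derivative of the composite is a
  sum of products of \<open>\<gamma>\<^sub>i'\<close> with composites of the smooth functions \<open>\<partial>\<^sub>i F\<close>.
\<close>

lemma times_differentiable_compose:
  assumes "open I" and W: "openin (coord_space n) W" and "smooth_on n W F"
    and \<gamma>W: "\<And>t. t \<in> I \<Longrightarrow> \<gamma> t \<in> W"
    and "\<And>i. i < n \<Longrightarrow> times_differentiable k I (\<lambda>t. \<gamma> t i)"
  shows "times_differentiable k I (\<lambda>t. F (\<gamma> t))"
  using assms(3,5)
proof (induction k arbitrary: F)
  case (Suc k)
  have d: "((\<lambda>s. F (\<gamma> s)) has_real_derivative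
      (\<Sum>i<n. partial i F (\<gamma> t) * deriv (\<lambda>s. \<gamma> s i) t)) (at t)" if t: "t \<in> I" for t
  proof (rule chain_rule_curve[OF W Suc.prems(1)])
    show "\<forall>\<^sub>F s in nhds t. \<gamma> s \<in> W"
      using eventually_nhds_in_open[OF assms(1) t] by eventually_elim (rule \<gamma>W)
    show "((\<lambda>s. \<gamma> s i) has_real_derivative deriv (\<lambda>s. \<gamma> s i) t) (at t)" if "i < n" for i
      using Suc.prems(2)[OF that] t by (simp add: DERIV_deriv_iff_real_differentiable)
  qed
  have "times_differentiable k I (\<lambda>t. \<Sum>i<n. partial i F (\<gamma> t) * deriv (\<lambda>s. \<gamma> s i) t)"
  proof (intro times_differentiable_sum[OF assms(1)] times_differentiable_mult[OF assms(1)])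
    fix i assume i: "i < n"
    show "times_differentiable k I (\<lambda>t. partial i F (\<gamma> t))"
      by (rule Suc.IH[OF smooth_on_partial[OF Suc.prems(1) i]])
        (rule times_differentiable_Suc_imp[OF Suc.prems(2)])
    show "times_differentiable k I (deriv (\<lambda>s. \<gamma> s i))"
      using Suc.prems(2)[OF i] by simp
  qed
  then have "times_differentiable k I (deriv (\<lambda>s. F (\<gamma> s)))"
    by (rule times_differentiable_cong[OF assms(1), rotated]) (use d DERIV_imp_deriv in force)
  then show ?case using d real_differentiable_def by auto
qed simp

section \<open>Pushforward of tangent vectors along smooth maps\<close>

lemma chart_props:
  assumes "smooth_manifold M" "(U, \<phi>) \<in> atlas M"
  shows "openin (mtop M) U" "U \<subseteq> points M" "inj_on \<phi> U" "\<phi> ` U \<subseteq> extensional {..<mdim M}"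
    "\<And>V. openin (mtop M) V \<Longrightarrow> openin (coord_space (mdim M)) (\<phi> ` (U \<inter> V))"
proof -
  have U: "openin (mtop M) U" and \<phi>U: "openin (coord_space (mdim M)) (\<phi> ` U)"
    and hm: "homeomorphic_map (subtopology (mtop M) U)
      (subtopology (coord_space (mdim M)) (\<phi> ` U)) \<phi>"
    using assms unfolding smooth_manifold_def by blast+
  show "openin (mtop M) U" by fact
  show UM: "U \<subseteq> points M" using U by (rule openin_subset)
  show "inj_on \<phi> U"
    using homeomorphic_imp_injective_map[OF hm] UM by (simp add: inf.absorb2)
  show "\<phi> ` U \<subseteq> extensional {..<mdim M}"
    using openin_subset[OF \<phi>U] by (simp add: topspace_coord_space)
  fix V assume V: "openin (mtop M) V"
  have "openin (subtopology (mtop M) U) (U \<inter> V)"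
    using V by (auto simp: openin_subtopology)
  then have "openin (subtopology (coord_space (mdim M)) (\<phi> ` U)) (\<phi> ` (U \<inter> V))"
    using homeomorphic_imp_open_map[OF hm] unfolding open_map_def by blast
  then show "openin (coord_space (mdim M)) (\<phi> ` (U \<inter> V))"
    using \<phi>U by (rule openin_trans_full)
qed

lemma chart_at:
  assumes "smooth_manifold M" "p \<in> points M"
  obtains U \<phi> where "(U, \<phi>) \<in> atlas M" "p \<in> U"
proof -
  have "p \<in> (\<Union>(U, \<phi>)\<in>atlas M. U)" using assms by (simp add: smooth_manifold_def)
  then show ?thesis using that by blast
qed

lemma smooth_map_id: "smooth_manifold M \<Longrightarrow> smooth_map M M (\<lambda>x. x)"
  unfolding smooth_map_def smooth_manifold_def by simp

definition curve_in_chart ::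
    "'a mfd \<Rightarrow> 'a set \<Rightarrow> ('a \<Rightarrow> nat \<Rightarrow> real) \<Rightarrow> real \<Rightarrow> (real \<Rightarrow> 'a) \<Rightarrow> bool" where
  "curve_in_chart M U \<phi> \<epsilon> c \<longleftrightarrow> \<epsilon> > 0 \<and> (U, \<phi>) \<in> atlas M \<and> c ` {-\<epsilon><..<\<epsilon>} \<subseteq> U \<and>
     (\<forall>i<mdim M. \<forall>k. times_differentiable k {-\<epsilon><..<\<epsilon>} (\<lambda>s. \<phi> (c s) i))"

lemma curves_iff: "c \<in> curves M p \<longleftrightarrow> c 0 = p \<and> (\<exists>U \<phi> \<epsilon>. curve_in_chart M U \<phi> \<epsilon> c)"
proof -
  have "(\<forall>k. times_differentiable k I f) \<longleftrightarrow> (\<forall>k. \<forall>t\<in>I. (deriv ^^ k) f differentiable at t)" for I f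
    unfolding times_differentiable_iff by blast
  then show ?thesis
    unfolding curves_def curve_in_chart_def by (simp, blast)
qed

text \<open>
  This is continuity of \<open>c\<close> at \<open>0\<close>: the coordinates of \<open>c\<close> are continuous, and the chart \<open>\<phi>\<close> maps
  open subsets of \<open>U\<close> to open sets injectively.
\<close>

lemma curve_eventually_in_open:
  assumes M: "smooth_manifold M" and c: "curve_in_chart M U \<phi> \<epsilon> c"
    and V: "openin (mtop M) V" "c 0 \<in> V"
  shows "\<forall>\<^sub>F s in nhds 0. c s \<in> U \<inter> V"
proof -
  have atl: "(U, \<phi>) \<in> atlas M" and \<epsilon>: "\<epsilon> > 0" and cU: "c ` {-\<epsilon><..<\<epsilon>} \<subseteq> U"
    and df: "\<And>i. i < mdim M \<Longrightarrow> times_differentiable (Suc 0) {-\<epsilon><..<\<epsilon>} (\<lambda>s. \<phi> (c s) i)"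
    using c by (auto simp: curve_in_chart_def simp del: times_differentiable.simps)
  note ch = chart_props[OF M atl]
  have I: "\<forall>\<^sub>F s in nhds 0. s \<in> {-\<epsilon><..<\<epsilon>}" by (rule eventually_nhds_in_open) (use \<epsilon> in auto)
  then have evU: "\<forall>\<^sub>F s in nhds 0. c s \<in> U" by eventually_elim (use cU in auto)
  have "\<forall>\<^sub>F s in nhds 0. \<phi> (c s) \<in> \<phi> ` (U \<inter> V)"
  proof (rule eventually_in_open_coord_space[OF ch(5)[OF V(1)]])
    show "\<phi> (c 0) \<in> \<phi> ` (U \<inter> V)" using eventually_nhds_x_imp_x[OF evU] V by auto
    show "\<forall>\<^sub>F s in nhds 0. \<phi> (c s) \<in> extensional {..<mdim M}"
      using evU by eventually_elim (use ch(4) in auto)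
    fix i assume "i < mdim M"
    then have "(\<lambda>s. \<phi> (c s) i) differentiable at 0" using df \<epsilon> by simp
    then have "isCont (\<lambda>s. \<phi> (c s) i) 0" by (rule differentiable_imp_continuous_within)
    then show "((\<lambda>s. \<phi> (c s) i) \<longlongrightarrow> \<phi> (c 0) i) (nhds 0)"
      unfolding isCont_def tendsto_at_iff_tendsto_nhds[of "\<lambda>s. \<phi> (c s) i"] .
  qed
  with evU show ?thesis
  proof eventually_elim
    case (elim s)
    then show ?case using inj_onD[OF ch(3)] by fastforce
  qed
qed

text \<open>
  Read in charts, \<open>f \<circ> c\<close> is the composite of the coordinate expression of \<open>f\<close> with the coordinates
  of \<open>c\<close>. For \<open>f = id\<close> this says that smoothness of \<open>c\<close> does not depend on the chart. The formula
  for the velocity shows that it depends on \<open>c\<close> only through the velocity of \<open>c\<close>.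
\<close>

lemma smooth_map_curve:
  assumes M: "smooth_manifold M" and N: "smooth_manifold N" and f: "smooth_map M N f"
    and c: "curve_in_chart M U \<phi> \<epsilon> c" and V: "(V, \<psi>) \<in> atlas N" and fV: "f (c 0) \<in> V"
  shows "\<exists>\<delta>. curve_in_chart N V \<psi> \<delta> (f \<circ> c)"
    and "i < mdim N \<Longrightarrow> deriv (\<lambda>s. \<psi> (f (c s)) i) 0 =
      (\<Sum>j<mdim M. partial j (\<lambda>y. \<psi> (f (the_inv_into U \<phi> y)) i) (\<phi> (c 0)) * deriv (\<lambda>s. \<phi> (c s) j) 0)"
proof -
  have atl: "(U, \<phi>) \<in> atlas M" and \<epsilon>: "\<epsilon> > 0" and cU: "c ` {-\<epsilon><..<\<epsilon>} \<subseteq> U"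
    and df: "\<And>i k. i < mdim M \<Longrightarrow> times_differentiable k {-\<epsilon><..<\<epsilon>} (\<lambda>s. \<phi> (c s) i)"
    using c by (auto simp: curve_in_chart_def)
  note chU = chart_props[OF M atl] and chV = chart_props[OF N V]
  define V' where "V' = {x \<in> points M. f x \<in> V}"
  have V': "openin (mtop M) V'"
    unfolding V'_def by (rule openin_continuous_map_preimage[OF _ chV(1)]) (use f in \<open>simp add: smooth_map_def\<close>)
  have UV': "U \<inter> f -` V = U \<inter> V'" using chU(2) by (auto simp: V'_def)
  let ?W = "\<phi> ` (U \<inter> f -` V)" and ?F = "\<lambda>i y. \<psi> (f (the_inv_into U \<phi> y)) i"
  have W: "openin (coord_space (mdim M)) ?W" unfolding UV' by (rule chU(5)[OF V'])
  have F: "smooth_on (mdim M) ?W (?F i)" if "i < mdim N" for i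
    using f atl V that unfolding smooth_map_def by blast
  have F_eq: "?F i (\<phi> (c s)) = \<psi> (f (c s)) i" if "c s \<in> U" for i s
    using that chU(3) by (simp add: the_inv_into_f_f)
  have ev: "\<forall>\<^sub>F s in nhds 0. c s \<in> U \<inter> V'"
  proof (rule curve_eventually_in_open[OF M c V'])
    have "c 0 \<in> U" using cU \<epsilon> by (simp add: image_subset_iff)
    then show "c 0 \<in> V'" using chU(2) fV by (auto simp: V'_def)
  qed
  then obtain \<delta>\<^sub>0 where \<delta>\<^sub>0: "\<delta>\<^sub>0 > 0" "\<And>s. \<bar>s\<bar> < \<delta>\<^sub>0 \<Longrightarrow> c s \<in> U \<inter> V'"
    unfolding eventually_nhds_metric by (auto simp: dist_real_def)
  define \<delta> where "\<delta> = min \<epsilon> \<delta>\<^sub>0"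
  let ?I = "{-\<delta><..<\<delta>}"
  have \<delta>: "\<delta> > 0" "\<delta> \<le> \<epsilon>" using \<epsilon> \<delta>\<^sub>0 by (auto simp: \<delta>_def)
  have cI: "c s \<in> U \<inter> f -` V" if "s \<in> ?I" for s
  proof -
    have "\<bar>s\<bar> < \<delta>\<^sub>0" using that by (auto simp: \<delta>_def)
    then show ?thesis unfolding UV' by (rule \<delta>\<^sub>0(2))
  qed
  have "times_differentiable k ?I (\<lambda>s. \<psi> (f (c s)) i)" if i: "i < mdim N" for i k
  proof (rule times_differentiable_cong)
    show "times_differentiable k ?I (\<lambda>s. ?F i (\<phi> (c s)))"
    proof (rule times_differentiable_compose[OF _ W F[OF i]])
      show "times_differentiable k ?I (\<lambda>s. \<phi> (c s) j)" if "j < mdim M" for j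
        by (rule times_differentiable_subset[OF df[OF that]]) (use \<delta>(2) in auto)
    qed (use cI in auto)
    show "?F i (\<phi> (c s)) = \<psi> (f (c s)) i" if "s \<in> ?I" for s using F_eq cI[OF that] by blast
  qed simp
  then show "\<exists>\<delta>. curve_in_chart N V \<psi> \<delta> (f \<circ> c)"
    using \<delta>(1) V cI by (intro exI[of _ \<delta>]) (auto simp: curve_in_chart_def)
  assume i: "i < mdim N"
  have "((\<lambda>s. ?F i (\<phi> (c s))) has_real_derivative
      (\<Sum>j<mdim M. partial j (?F i) (\<phi> (c 0)) * deriv (\<lambda>s. \<phi> (c s) j) 0)) (at 0)"
  proof (rule chain_rule_curve[OF W F[OF i]])
    show "\<forall>\<^sub>F s in nhds 0. \<phi> (c s) \<in> ?W"
      using ev by eventually_elim (auto simp: UV')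
    show "((\<lambda>s. \<phi> (c s) j) has_real_derivative deriv (\<lambda>s. \<phi> (c s) j) 0) (at 0)"
      if "j < mdim M" for j
      using df[OF that, of "Suc 0"] \<epsilon> by (simp add: DERIV_deriv_iff_real_differentiable)
  qed
  moreover have "\<forall>\<^sub>F s in nhds 0. ?F i (\<phi> (c s)) = \<psi> (f (c s)) i"
    using ev by eventually_elim (use F_eq in auto)
  ultimately have "((\<lambda>s. \<psi> (f (c s)) i) has_real_derivative
      (\<Sum>j<mdim M. partial j (?F i) (\<phi> (c 0)) * deriv (\<lambda>s. \<phi> (c s) j) 0)) (at 0)"
    using DERIV_cong_ev[OF refl _ refl, of "\<lambda>s. ?F i (\<phi> (c s))" "\<lambda>s. \<psi> (f (c s)) i"] by simp
  then show "deriv (\<lambda>s. \<psi> (f (c s)) i) 0 =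
      (\<Sum>j<mdim M. partial j (?F i) (\<phi> (c 0)) * deriv (\<lambda>s. \<phi> (c s) j) 0)"
    by (rule DERIV_imp_deriv)
qed

lemma curve_in_any_chart:
  assumes M: "smooth_manifold M" and c: "c \<in> curves M p" and V: "(V, \<psi>) \<in> atlas M" "p \<in> V"
  shows "\<exists>\<delta>. curve_in_chart M V \<psi> \<delta> c"
proof -
  obtain U \<phi> \<epsilon> where "curve_in_chart M U \<phi> \<epsilon> c" "c 0 = p" using c by (auto simp: curves_iff)
  then show ?thesis
    using smooth_map_curve(1)[OF M M smooth_map_id[OF M] _ V(1)] V(2) by (fastforce simp: comp_def)
qed

text \<open>
  Both curves are compared in one chart \<open>U\<close> of \<open>M\<close>, in which the chain rule expresses the velocities
  of the images by the same linear combination of the velocities.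
\<close>

lemma smooth_map_tangent_rel:
  assumes M: "smooth_manifold M" and N: "smooth_manifold N" and f: "smooth_map M N f"
    and cc': "(c, c') \<in> tangent_rel M p"
  shows "(f \<circ> c, f \<circ> c') \<in> tangent_rel N (f p)"
proof -
  have c: "c \<in> curves M p" and c': "c' \<in> curves M p"
    using cc' by (auto simp: tangent_rel_def)
  then have c0: "c 0 = p" "c' 0 = p" by (auto simp: curves_iff)
  obtain U \<phi> \<epsilon> where ch: "curve_in_chart M U \<phi> \<epsilon> c" using c by (auto simp: curves_iff)
  then have U: "(U, \<phi>) \<in> atlas M" and pU: "p \<in> U" using c0 by (auto simp: curve_in_chart_def)
  obtain \<epsilon>' where ch': "curve_in_chart M U \<phi> \<epsilon>' c'" using curve_in_any_chart[OF M c' U pU] by blast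
  have eq: "deriv (\<lambda>s. \<phi> (c s) j) 0 = deriv (\<lambda>s. \<phi> (c' s) j) 0" if "j < mdim M" for j
    using cc' U pU that unfolding tangent_rel_def by blast
  have "p \<in> points M" using chart_props(2)[OF M U] pU by blast
  then have "f p \<in> points N"
    using f continuous_map_image_subset_topspace unfolding smooth_map_def by blast
  then obtain V \<psi> where V: "(V, \<psi>) \<in> atlas N" "f p \<in> V" using chart_at[OF N] by metis
  have "f \<circ> c \<in> curves N (f p)" "f \<circ> c' \<in> curves N (f p)"
    using smooth_map_curve(1)[OF M N f ch V(1)] smooth_map_curve(1)[OF M N f ch' V(1)] c0 V(2)
    by (auto simp: curves_iff)
  moreover have "deriv (\<lambda>s. \<psi> ((f \<circ> c) s) i) 0 = deriv (\<lambda>s. \<psi> ((f \<circ> c') s) i) 0"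
    if V: "(V, \<psi>) \<in> atlas N" "f p \<in> V" and i: "i < mdim N" for V \<psi> i
    using smooth_map_curve(2)[OF M N f ch V(1) _ i] smooth_map_curve(2)[OF M N f ch' V(1) _ i] V(2)
    by (simp add: c0 eq)
  ultimately show ?thesis unfolding tangent_rel_def by blast
qed

lemma tangent_rel_iff:
  "(c, c') \<in> tangent_rel M p \<longleftrightarrow> c \<in> curves M p \<and> c' \<in> curves M p \<and>
     (\<forall>U \<phi> i. (U, \<phi>) \<in> atlas M \<longrightarrow> p \<in> U \<longrightarrow> i < mdim M \<longrightarrow>
        deriv (\<lambda>t. \<phi> (c t) i) 0 = deriv (\<lambda>t. \<phi> (c' t) i) 0)"
  unfolding tangent_rel_def by blast

lemma equiv_tangent_rel: "equiv (curves M p) (tangent_rel M p)"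
proof (intro equivI refl_onI symI transI)
  show "tangent_rel M p \<subseteq> curves M p \<times> curves M p" by (auto simp: tangent_rel_iff)
  show "(c, c) \<in> tangent_rel M p" if "c \<in> curves M p" for c
    using that by (simp add: tangent_rel_iff)
  show "(c', c) \<in> tangent_rel M p" if "(c, c') \<in> tangent_rel M p" for c c'
    using that unfolding tangent_rel_iff by metis
  show "(c, c'') \<in> tangent_rel M p" if "(c, c') \<in> tangent_rel M p" "(c', c'') \<in> tangent_rel M p"
    for c c' c''
    using that unfolding tangent_rel_iff by metis
qed

lemma tangent_vector_props:
  assumes "v \<in> tangent_space M p" "c \<in> v"
  shows "c \<in> curves M p" "v = tangent_rel M p `` {c}"
proof -
  obtain c' where c': "c' \<in> curves M p" "v = tangent_rel M p `` {c'}"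
    using assms(1) unfolding tangent_space_def by (rule quotientE)
  then have cc': "(c', c) \<in> tangent_rel M p" using assms(2) by simp
  then show "v = tangent_rel M p `` {c}"
    unfolding c'(2) by (rule equiv_class_eq[OF equiv_tangent_rel])
  show "c \<in> curves M p" using cc' by (simp add: tangent_rel_iff)
qed

lemma tangent_vector_nonempty:
  assumes "v \<in> tangent_space M p"
  obtains c where "c \<in> v"
proof -
  have "v \<noteq> {}"
    using assms unfolding tangent_space_def by (rule in_quotient_imp_non_empty[OF equiv_tangent_rel])
  then show ?thesis using that by blast
qed

lemma pushforward_eq:
  assumes M: "smooth_manifold M" and N: "smooth_manifold N" and f: "smooth_map M N f"
    and v: "v \<in> tangent_space M p" "c \<in> v"
  shows "pushforward N f p v = tangent_rel N (f p) `` {f \<circ> c}"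
proof -
  have "tangent_rel N (f p) `` {f \<circ> c'} = tangent_rel N (f p) `` {f \<circ> c}" if "c' \<in> v" for c'
  proof -
    have "(c, c') \<in> tangent_rel M p" using tangent_vector_props(2)[OF v] that by blast
    then show ?thesis
      using equiv_class_eq[OF equiv_tangent_rel smooth_map_tangent_rel[OF M N f]] by blast
  qed
  then have "pushforward N f p v = (\<Union>c'\<in>v. tangent_rel N (f p) `` {f \<circ> c})"
    unfolding pushforward_def by (rule SUP_cong[OF refl])
  then show ?thesis using v(2) by (simp only: UN_constant) auto
qed

lemma pushforward_in_tangent_space:
  assumes "smooth_manifold M" "smooth_manifold N" "smooth_map M N f"
    and "v \<in> tangent_space M p"
  shows "pushforward N f p v \<in> tangent_space N (f p)"
    and "c \<in> v \<Longrightarrow> f \<circ> c \<in> pushforward N f p v"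
proof -
  have *: "(f \<circ> c, f \<circ> c) \<in> tangent_rel N (f p)" if "c \<in> v" for c
    using tangent_vector_props(1)[OF assms(4) that]
    by (intro smooth_map_tangent_rel[OF assms(1-3)]) (simp add: tangent_rel_iff)
  obtain c where c: "c \<in> v" using tangent_vector_nonempty[OF assms(4)] .
  have "f \<circ> c \<in> curves N (f p)" using *[OF c] by (simp add: tangent_rel_def)
  then show "pushforward N f p v \<in> tangent_space N (f p)"
    unfolding pushforward_eq[OF assms c] tangent_space_def by (rule quotientI)
  show "f \<circ> c \<in> pushforward N f p v" if "c \<in> v" for c
    using *[OF that] unfolding pushforward_eq[OF assms that] by blast
qed

section \<open>Measure-preserving maps on the projective Hilbert space\<close>

lemma equiv_ae_rel: "equiv (L2_fun \<mu>) (ae_rel \<mu>)"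
proof (intro equivI refl_onI symI transI)
  show "(f, f'') \<in> ae_rel \<mu>" if "(f, f') \<in> ae_rel \<mu>" "(f', f'') \<in> ae_rel \<mu>" for f f' f''
  proof -
    have "AE x in \<mu>. f x = f' x" "AE x in \<mu>. f' x = f'' x" using that by (auto simp: ae_rel_def)
    then have "AE x in \<mu>. f x = f'' x" by eventually_elim (rule trans)
    then show ?thesis using that by (simp add: ae_rel_def)
  qed
  show "(f', f) \<in> ae_rel \<mu>" if "(f, f') \<in> ae_rel \<mu>" for f f'
  proof -
    have "AE x in \<mu>. f x = f' x" using that by (simp add: ae_rel_def)
    then have "AE x in \<mu>. f' x = f x" by eventually_elim (rule sym)
    then show ?thesis using that by (simp add: ae_rel_def)
  qed
qed (auto simp: ae_rel_def)

lemma L2_class_eq: "(f, f') \<in> ae_rel \<mu> \<Longrightarrow> L2_class \<mu> f = L2_class \<mu> f'"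
  unfolding L2_class_def by (rule equiv_class_eq[OF equiv_ae_rel])

lemma L2_class_self: "f \<in> L2_fun \<mu> \<Longrightarrow> f \<in> L2_class \<mu> f"
  by (auto simp: L2_class_def ae_rel_def)

lemma L2_class_mem: "f' \<in> L2_class \<mu> f \<Longrightarrow> (f, f') \<in> ae_rel \<mu>"
  by (simp add: L2_class_def)

lemma L2_class_in_L2: "f \<in> L2_fun \<mu> \<Longrightarrow> L2_class \<mu> f \<in> L2 \<mu>"
  unfolding L2_def L2_class_def by (rule quotientI)

lemma L2_cases:
  assumes "F \<in> L2 \<mu>" obtains f where "f \<in> L2_fun \<mu>" "F = L2_class \<mu> f"
  using assms unfolding L2_def L2_class_def by (rule quotientE)

lemma L2_class_eq_iff:
  "f \<in> L2_fun \<mu> \<Longrightarrow> f' \<in> L2_fun \<mu> \<Longrightarrow> L2_class \<mu> f = L2_class \<mu> f' \<longleftrightarrow> (AE x in \<mu>. f x = f' x)"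
  unfolding L2_class_def by (subst eq_equiv_class_iff[OF equiv_ae_rel]) (auto simp: ae_rel_def)

lemma L2_fun_zero: "(\<lambda>_. 0) \<in> L2_fun \<mu>"
  by (simp add: L2_fun_def)

lemma L2_fun_scale: "f \<in> L2_fun \<mu> \<Longrightarrow> (\<lambda>x. a * f x) \<in> L2_fun \<mu>"
  by (auto simp: L2_fun_def norm_mult power_mult_distrib intro: borel_measurable_times)

text \<open>An operation on functions that respects equality almost everywhere acts on classes.\<close>

lemma L2_class_UN:
  assumes f: "f \<in> L2_fun \<mu>" and T: "\<And>f'. (f, f') \<in> ae_rel \<mu> \<Longrightarrow> (T f, T f') \<in> ae_rel \<mu>"
  shows "(\<Union>f'\<in>L2_class \<mu> f. L2_class \<mu> (T f')) = L2_class \<mu> (T f)"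
proof -
  have "(\<Union>f'\<in>L2_class \<mu> f. L2_class \<mu> (T f')) = (\<Union>f'\<in>L2_class \<mu> f. L2_class \<mu> (T f))"
    by (rule SUP_cong[OF refl]) (rule L2_class_eq[OF T[OF L2_class_mem], symmetric])
  then show ?thesis using L2_class_self[OF f] by (simp only: UN_constant) auto
qed

lemma L2_scale_class:
  assumes f: "f \<in> L2_fun \<mu>"
  shows "L2_scale \<mu> a (L2_class \<mu> f) = L2_class \<mu> (\<lambda>x. a * f x)"
  unfolding L2_scale_def
  by (rule L2_class_UN[OF f, where T = "\<lambda>f x. a * f x"])
    (auto simp: ae_rel_def L2_fun_scale elim: eventually_mono)

lemma L2_scale_scale:
  "F \<in> L2 \<mu> \<Longrightarrow> L2_scale \<mu> a (L2_scale \<mu> b F) = L2_scale \<mu> (a * b) F"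
  by (erule L2_cases) (simp add: L2_scale_class L2_fun_scale mult.assoc)

lemma L2_scale_one: "F \<in> L2 \<mu> \<Longrightarrow> L2_scale \<mu> 1 F = F"
  by (erule L2_cases) (simp add: L2_scale_class)

lemma proj_relI:
  assumes "F \<in> L2 \<mu> - {L2_zero \<mu>}" "F' \<in> L2 \<mu> - {L2_zero \<mu>}" "a \<noteq> 0" "F' = L2_scale \<mu> a F"
  shows "(F, F') \<in> proj_rel \<mu>"
  using assms unfolding proj_rel_def by blast

lemma proj_relE:
  assumes "(F, F') \<in> proj_rel \<mu>"
  obtains a where "F \<in> L2 \<mu> - {L2_zero \<mu>}" "F' \<in> L2 \<mu> - {L2_zero \<mu>}" "a \<noteq> 0" "F' = L2_scale \<mu> a F"
  using assms unfolding proj_rel_def by blast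

lemma equiv_proj_rel: "equiv (L2 \<mu> - {L2_zero \<mu>}) (proj_rel \<mu>)"
proof (intro equivI refl_onI symI transI)
  show "proj_rel \<mu> \<subseteq> (L2 \<mu> - {L2_zero \<mu>}) \<times> (L2 \<mu> - {L2_zero \<mu>})"
    unfolding proj_rel_def by blast
  show "(F, F) \<in> proj_rel \<mu>" if "F \<in> L2 \<mu> - {L2_zero \<mu>}" for F
    using that L2_scale_one[of F \<mu>] by (intro proj_relI[of _ _ _ 1]) auto
  show "(F', F) \<in> proj_rel \<mu>" if "(F, F') \<in> proj_rel \<mu>" for F F'
    using that
  proof (rule proj_relE)
    fix a assume F: "F \<in> L2 \<mu> - {L2_zero \<mu>}" "F' \<in> L2 \<mu> - {L2_zero \<mu>}"
      and a: "a \<noteq> 0" "F' = L2_scale \<mu> a F"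
    have "F = L2_scale \<mu> (1 / a) F'" using a F(1) by (simp add: L2_scale_scale L2_scale_one)
    then show ?thesis using a(1) by (intro proj_relI[OF F(2,1), of "1 / a"]) auto
  qed
  show "(F, F'') \<in> proj_rel \<mu>" if FF: "(F, F') \<in> proj_rel \<mu>" "(F', F'') \<in> proj_rel \<mu>" for F F' F''
    using FF(1)
  proof (rule proj_relE)
    fix a assume F: "F \<in> L2 \<mu> - {L2_zero \<mu>}" and a: "a \<noteq> 0" "F' = L2_scale \<mu> a F"
    show ?thesis using FF(2)
    proof (rule proj_relE)
      fix b assume F'': "F'' \<in> L2 \<mu> - {L2_zero \<mu>}" and b: "b \<noteq> 0" "F'' = L2_scale \<mu> b F'"
      have "F'' = L2_scale \<mu> (b * a) F" using a b F by (simp add: L2_scale_scale)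
      then show ?thesis using a(1) b(1) by (intro proj_relI[OF F F'', of "b * a"]) auto
    qed
  qed
qed

lemma L2_fun_compose:
  assumes T: "T \<in> measurable \<mu> \<mu>" "distr \<mu> \<mu> T = \<mu>" and f: "f \<in> L2_fun \<mu>"
  shows "(\<lambda>x. f (T x)) \<in> L2_fun \<mu>"
proof -
  have [measurable]: "f \<in> borel_measurable \<mu>" and i: "integrable \<mu> (\<lambda>x. (cmod (f x))\<^sup>2)"
    using f by (auto simp: L2_fun_def)
  have "integrable (distr \<mu> \<mu> T) (\<lambda>x. (cmod (f x))\<^sup>2)" using i T(2) by simp
  then have "integrable \<mu> (\<lambda>x. (cmod (f (T x)))\<^sup>2)"
    by (rule integrable_distr[OF T(1)])
  then show ?thesis using T(1) by (simp add: L2_fun_def)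
qed

lemma AE_compose:
  assumes T: "T \<in> measurable \<mu> \<mu>" "distr \<mu> \<mu> T = \<mu>" and "AE x in \<mu>. Q x"
  shows "AE x in \<mu>. Q (T x)"
proof -
  have "AE x in distr \<mu> \<mu> T. Q x" unfolding T(2) by (rule assms(3))
  then show ?thesis by (rule AE_distrD[OF T(1)])
qed

lemma ae_rel_compose:
  assumes T: "T \<in> measurable \<mu> \<mu>" "distr \<mu> \<mu> T = \<mu>" and "(f, f') \<in> ae_rel \<mu>"
  shows "(\<lambda>x. f (T x), \<lambda>x. f' (T x)) \<in> ae_rel \<mu>"
proof -
  have f: "f \<in> L2_fun \<mu>" "f' \<in> L2_fun \<mu>" and eq: "AE x in \<mu>. f x = f' x"
    using assms(3) by (auto simp: ae_rel_def)
  show ?thesis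
    unfolding ae_rel_def
    using L2_fun_compose[OF T f(1)] L2_fun_compose[OF T f(2)] AE_compose[OF T eq] by blast
qed

section \<open>Equivariance\<close>

context statistical_transformation_model
begin

lemma sets_\<mu>: "sets \<mu> = sets (borel_of (mtop X))"
  using measure by (simp add: riemannian_measure_def)

lemma space_\<mu>: "space \<mu> = points X"
  using sets_eq_imp_space_eq[OF sets_\<mu>]
  by (simp add: borel_of_def space_measure_of_conv)

lemma group_G: "group G"
  using lie_group by (simp add: lie_group_def)

text \<open>The map \<open>act g\<close> is continuous, as a slice of the jointly continuous action, and \<open>\<mu>\<close> is a Borel measure.\<close>

lemma act_measurable:
  assumes g: "g \<in> carrier G"
  shows "act g \<in> measurable \<mu> \<mu>"
proof -
  have a: "continuous_map (prod_topology (mtop L) (mtop X)) (mtop X) (\<lambda>(g, x). act g x)"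
    using action_X by (simp add: smooth_action_def smooth_map_def prod_mfd_def)
  have b: "continuous_map (mtop X) (prod_topology (mtop L) (mtop X)) (\<lambda>x. (g, x))"
    using g lie_group by (auto simp: continuous_map_pairwise comp_def lie_group_def)
  have c: "continuous_map (mtop X) (mtop X) (act g)"
    using continuous_map_compose[OF b a] by (simp add: comp_def)
  have "act g \<in> measurable (borel_of (mtop X)) (borel_of (mtop X))"
  proof (subst (2) borel_of_def, rule measurable_measure_of)
    show "{U. openin (mtop X) U} \<subseteq> Pow (points X)" using openin_subset by blast
    show "act g \<in> space (borel_of (mtop X)) \<rightarrow> points X"
      using continuous_map_image_subset_topspace[OF c] by (auto simp: borel_of_def space_measure_of_conv)
    fix U assume "U \<in> {U. openin (mtop X) U}"
    then have "openin (mtop X) {x \<in> points X. act g x \<in> U}"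
      using openin_continuous_map_preimage[OF c] by blast
    moreover have "act g -` U \<inter> space (borel_of (mtop X)) = {x \<in> points X. act g x \<in> U}"
      by (auto simp: borel_of_def space_measure_of_conv)
    ultimately show "act g -` U \<inter> space (borel_of (mtop X)) \<in> sets (borel_of (mtop X))"
      unfolding borel_of_def by (auto intro!: in_measure_of dest: openin_subset)
  qed
  then show ?thesis using measurable_cong_sets[OF sets_\<mu> sets_\<mu>] by simp
qed

lemma act_space: "g \<in> carrier G \<Longrightarrow> x \<in> space \<mu> \<Longrightarrow> act g x \<in> space \<mu>"
  using act_measurable by (rule measurable_space)

lemma act_inv:
  assumes g: "g \<in> carrier G" and x: "x \<in> space \<mu>"
  shows "act (inv g) (act g x) = x" "act g (act (inv g) x) = x"
proof -
  have ga: "group_action G (points X) act" using action_X by (simp add: smooth_action_def)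
  have inv_act: "act (inv k) (act k x) = x" if "k \<in> carrier G" for k
    using group_action.orbit_sym_aux[OF ga that _ refl] x by (simp add: space_\<mu>)
  show "act (inv g) (act g x) = x" by (rule inv_act[OF g])
  show "act g (act (inv g) x) = x"
    using inv_act[of "inv g"] g by (simp add: group.inv_closed[OF group_G] group.inv_inv[OF group_G])
qed

lemma inv_act_preserves:
  assumes g: "g \<in> carrier G"
  shows "act (inv g) \<in> measurable \<mu> \<mu>" "distr \<mu> \<mu> (act (inv g)) = \<mu>"
  by (rule act_measurable measure_invariant, rule group.inv_closed[OF group_G g])+

text \<open>The function \<open>\<surd>p exp(i v / 2)\<close> whose class in \<open>L\<^sup>2\<close> is \<open>\<Phi>(p, v)\<close>.\<close>

abbreviation wave :: "'x measure \<Rightarrow> (real \<Rightarrow> 'x measure) set \<Rightarrow> 'x \<Rightarrow> complex" where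
  "wave P v \<equiv> \<lambda>x. complex_of_real (sqrt (dens P x)) * exp (\<i> * complex_of_real (score dens P v x) / 2)"

lemma L2_act_class:
  assumes g: "g \<in> carrier G" and f: "f \<in> L2_fun \<mu>"
  shows "L2_act \<mu> G act g (L2_class \<mu> f) = L2_class \<mu> (\<lambda>x. f (act (inv g) x))"
  unfolding L2_act_def
  by (rule L2_class_UN[OF f, where T = "\<lambda>f x. f (act (inv g) x)"])
    (rule ae_rel_compose[OF inv_act_preserves[OF g]])

text \<open>If \<open>f \<circ> g\<^sup>-\<^sup>1\<close> vanishes almost everywhere, then so does its composite with the measure-preserving \<open>g\<close>.\<close>

lemma L2_act_nonzero:
  assumes g: "g \<in> carrier G" and F: "F \<in> L2 \<mu> - {L2_zero \<mu>}"
  shows "L2_act \<mu> G act g F \<in> L2 \<mu> - {L2_zero \<mu>}"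
proof -
  obtain f where f: "f \<in> L2_fun \<mu>" "F = L2_class \<mu> f" using F by (blast elim: L2_cases)
  let ?f' = "\<lambda>x. f (act (inv g) x)"
  have f': "?f' \<in> L2_fun \<mu>" by (rule L2_fun_compose[OF inv_act_preserves[OF g] f(1)])
  have "\<not> (AE x in \<mu>. ?f' x = 0)"
  proof
    assume "AE x in \<mu>. ?f' x = 0"
    then have "AE x in \<mu>. ?f' (act g x) = 0"
      by (rule AE_compose[OF act_measurable[OF g] measure_invariant[OF g]])
    then have "AE x in \<mu>. f x = 0"
      using AE_space by eventually_elim (simp add: act_inv[OF g])
    then show False using F f L2_class_eq_iff[OF f(1) L2_fun_zero] by (simp add: L2_zero_def)
  qed
  then show ?thesis
    using f f' L2_class_eq_iff[OF f' L2_fun_zero] by (simp add: L2_act_class[OF g] L2_zero_def L2_class_in_L2)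
qed

lemma L2_act_scale:
  assumes g: "g \<in> carrier G" and F: "F \<in> L2 \<mu>"
  shows "L2_act \<mu> G act g (L2_scale \<mu> a F) = L2_scale \<mu> a (L2_act \<mu> G act g F)"
  using F
  by (rule L2_cases)
    (simp add: L2_scale_class L2_act_class[OF g] L2_fun_scale L2_fun_compose[OF inv_act_preserves[OF g]])

text \<open>
  The action on classes is a union over all representatives of the line. These are the multiples
  of \<open>F\<close>, and by linearity they are sent to multiples of the image of \<open>F\<close>.
\<close>

lemma PL2_act_class:
  assumes g: "g \<in> carrier G" and F: "F \<in> L2 \<mu> - {L2_zero \<mu>}"
  shows "PL2_act \<mu> G act g (proj_class \<mu> F) = proj_class \<mu> (L2_act \<mu> G act g F)"
proof -
  have "proj_class \<mu> (L2_act \<mu> G act g F') = proj_class \<mu> (L2_act \<mu> G act g F)"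
    if F': "F' \<in> proj_class \<mu> F" for F'
  proof -
    have FF': "(F, F') \<in> proj_rel \<mu>" using F' by (simp add: proj_class_def)
    then have "(L2_act \<mu> G act g F, L2_act \<mu> G act g F') \<in> proj_rel \<mu>"
    proof (rule proj_relE)
      fix a assume F': "F' \<in> L2 \<mu> - {L2_zero \<mu>}" and a: "a \<noteq> 0" "F' = L2_scale \<mu> a F"
      have "L2_act \<mu> G act g F' = L2_scale \<mu> a (L2_act \<mu> G act g F)"
        unfolding a(2) by (rule L2_act_scale[OF g]) (use F in simp)
      then show ?thesis by (rule proj_relI[OF L2_act_nonzero[OF g F] L2_act_nonzero[OF g F'] a(1)])
    qed
    then show ?thesis unfolding proj_class_def by (rule equiv_class_eq[OF equiv_proj_rel, symmetric])
  qed
  then have "PL2_act \<mu> G act g (proj_class \<mu> F) =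
      (\<Union>F'\<in>proj_class \<mu> F. proj_class \<mu> (L2_act \<mu> G act g F))"
    unfolding PL2_act_def by (rule SUP_cong[OF refl])
  moreover have "F \<in> proj_class \<mu> F"
    unfolding proj_class_def by (rule equiv_class_self[OF equiv_proj_rel F])
  ultimately show ?thesis by (simp only: UN_constant) auto
qed

lemma model_point:
  assumes "P \<in> points M"
  shows "prob_space P" "dens P \<in> borel_measurable \<mu>" "\<And>x. x \<in> space \<mu> \<Longrightarrow> dens P x \<ge> 0"
    "P = density \<mu> (\<lambda>x. ennreal (dens P x))"
  using model assms unfolding statistical_model_def by blast+

lemma manifold_M: "smooth_manifold M"
  using model by (simp add: statistical_model_def)

lemma measure_act_smooth: "g \<in> carrier G \<Longrightarrow> smooth_map M M (measure_act \<mu> act g)"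
  using diffeo_M by (simp add: diffeomorphism_def)

lemma measure_act_points: "g \<in> carrier G \<Longrightarrow> P \<in> points M \<Longrightarrow> measure_act \<mu> act g P \<in> points M"
  using diffeo_M bij_betwE by (fastforce simp: diffeomorphism_def)

text \<open>
  By invariance of \<open>\<mu>\<close>, the transported density is a density of \<open>g P\<close>, and densities are unique
  almost everywhere.
\<close>

lemma dens_measure_act:
  assumes g: "g \<in> carrier G" and P: "P \<in> points M"
  shows "AE x in \<mu>. dens (measure_act \<mu> act g P) x = dens P (act (inv g) x)"
proof -
  let ?Q = "measure_act \<mu> act g P" and ?p = "\<lambda>x. ennreal (dens P (act (inv g) x))"
  note mP = model_point[OF P] and mQ = model_point[OF measure_act_points[OF g P]]
  note ag = act_measurable[OF g] and ai = inv_act_preserves(1)[OF g]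
  have pm: "?p \<in> borel_measurable \<mu>"
    using measurable_compose[OF ai mP(2)] by simp
  have "density \<mu> ?p = density (distr \<mu> \<mu> (act g)) ?p" by (simp add: measure_invariant[OF g])
  also have "\<dots> = distr (density \<mu> (\<lambda>x. ?p (act g x))) \<mu> (act g)"
    by (rule density_distr[OF pm ag])
  also have "density \<mu> (\<lambda>x. ?p (act g x)) = density \<mu> (\<lambda>x. ennreal (dens P x))"
    by (rule density_cong) (use pm ag mP(2) in \<open>auto simp: act_inv[OF g]\<close>)
  also have "\<dots> = P" using mP(4) by simp
  finally have "density \<mu> ?p = ?Q" by (simp add: measure_act_def)
  then have eq: "density \<mu> (\<lambda>x. ennreal (dens ?Q x)) = density \<mu> ?p" using mQ(4) by simp
  have "(\<integral>\<^sup>+ x. ennreal (dens ?Q x) \<partial>\<mu>) = emeasure (density \<mu> (\<lambda>x. ennreal (dens ?Q x))) (space \<mu>)"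
    using mQ(2) by (simp add: emeasure_density cong: nn_integral_cong)
  also have "\<dots> = emeasure ?Q (space ?Q)"
    using mQ(4) by (metis space_density)
  also have "\<dots> = 1" by (rule prob_space.emeasure_space_1[OF mQ(1)])
  finally have "AE x in \<mu>. ennreal (dens ?Q x) = ?p x"
    using finite_density_unique[of "\<lambda>x. ennreal (dens ?Q x)" \<mu> ?p] pm mQ(2) eq by simp
  then show ?thesis
    by (rule AE_mp) (use mP(3) mQ(3) act_space g group_G in \<open>auto simp: group.inv_closed\<close>)
qed

text \<open>
  For each \<open>t\<close> the densities of \<open>g c(t)\<close> and of \<open>c(t)\<close> correspond outside a null set that depends on
  \<open>t\<close>. As the pointwise derivatives exist, they are limits of difference quotients along one
  sequence, so that only countably many null sets are discarded.
\<close>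

lemma density_deriv_pushforward:
  assumes g: "g \<in> carrier G" and P: "P \<in> points M" and v: "v \<in> tangent_space M P"
  shows "AE x in \<mu>. density_deriv dens (pushforward M (measure_act \<mu> act g) P v) x =
    density_deriv dens v (act (inv g) x)"
proof -
  let ?a = "measure_act \<mu> act g" and ?w = "pushforward M (measure_act \<mu> act g) P v"
  obtain c where c: "c \<in> v" using tangent_vector_nonempty[OF v] .
  have w: "?w \<in> tangent_space M (?a P)" and ac: "?a \<circ> c \<in> ?w"
    using pushforward_in_tangent_space[OF manifold_M manifold_M measure_act_smooth[OF g] v] c by auto
  have dv: "((\<lambda>t. dens (c t) x) has_real_derivative density_deriv dens v x) (at 0)"
    if "x \<in> space \<mu>" for x
    using model P v c that unfolding statistical_model_def by blast
  have dw: "((\<lambda>t. dens (?a (c t)) x) has_real_derivative density_deriv dens ?w x) (at 0)"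
    if x: "x \<in> space \<mu>" for x
  proof -
    have "((\<lambda>t. dens ((?a \<circ> c) t) x) has_real_derivative density_deriv dens ?w x) (at 0)"
      using model measure_act_points[OF g P] w ac x unfolding statistical_model_def by blast
    then show ?thesis by simp
  qed
  obtain U \<phi> \<epsilon> where ch: "curve_in_chart M U \<phi> \<epsilon> c"
    using tangent_vector_props(1)[OF v c] by (auto simp: curves_iff)
  then have \<epsilon>: "\<epsilon> > 0" by (simp add: curve_in_chart_def)
  have cM: "c t \<in> points M" if "\<bar>t\<bar> < \<epsilon>" for t
    using ch that chart_props(2)[OF manifold_M, of U \<phi>]
    by (auto simp: curve_in_chart_def abs_less_iff image_subset_iff)
  \<comment> \<open>The factor \<open>\<epsilon> / 2\<close> keeps the times \<open>r n\<close> in the interval on which \<open>c\<close> is known to stay in \<open>M\<close>.\<close>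
  define r :: "nat \<Rightarrow> real" where "r n = \<epsilon> / 2 * inverse (real (Suc n))" for n
  have r_pos: "r n > 0" for n using \<epsilon> by (simp add: r_def)
  have r_less: "\<bar>r n\<bar> < \<epsilon>" for n
  proof -
    have "inverse (real (Suc n)) \<le> 1" by (simp add: inverse_le_1_iff)
    then have "r n \<le> \<epsilon> / 2 * 1" unfolding r_def using \<epsilon> by (intro mult_left_mono) auto
    then show ?thesis using r_pos[of n] \<epsilon> by simp
  qed
  have "r \<longlonglongrightarrow> \<epsilon> / 2 * 0"
    unfolding r_def by (intro tendsto_mult tendsto_const LIMSEQ_inverse_real_of_nat)
  then have r: "filterlim r (at 0) sequentially"
    using r_pos[THEN less_imp_neq] by (simp add: filterlim_at eq_commute[of 0])
  have "AE x in \<mu>. \<forall>n. dens (?a (c (r n))) x = dens (c (r n)) (act (inv g) x)"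
    unfolding AE_all_countable using dens_measure_act[OF g cM[OF r_less]] by blast
  moreover have "AE x in \<mu>. dens (?a (c 0)) x = dens (c 0) (act (inv g) x)"
    using dens_measure_act[OF g cM] \<epsilon> by simp
  ultimately show ?thesis
    using AE_space
  proof eventually_elim
    case (elim x)
    have y: "act (inv g) x \<in> space \<mu>" using elim(3) act_space g group_G by (simp add: group.inv_closed)
    have "(\<lambda>n. (dens (?a (c (r n))) x - dens (?a (c 0)) x) / r n) \<longlonglongrightarrow> density_deriv dens ?w x"
      using filterlim_compose[OF _ r] dw[OF elim(3)] by (fastforce simp: has_field_derivative_iff)
    moreover have "(\<lambda>n. (dens (c (r n)) (act (inv g) x) - dens (c 0) (act (inv g) x)) / r n)
        \<longlonglongrightarrow> density_deriv dens v (act (inv g) x)"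
      using filterlim_compose[OF _ r] dv[OF y] by (fastforce simp: has_field_derivative_iff)
    ultimately show ?case using elim(1,2) LIMSEQ_unique by simp
  qed
qed

lemma wave_L2:
  assumes "P \<in> points M" "v \<in> tangent_space M P"
  shows "wave P v \<in> L2_fun \<mu>"
proof -
  have "L2_class \<mu> (wave P v) \<in> L2 \<mu>"
    using Phi_mem[OF model, of "(P, v)"] assms by (simp add: tangent_bundle_def Phi_def)
  then have "L2_class \<mu> (wave P v) \<noteq> {}"
    unfolding L2_def by (rule in_quotient_imp_non_empty[OF equiv_ae_rel])
  then show ?thesis by (auto simp: L2_class_def ae_rel_def)
qed

lemma bundle_act_tangent_bundle:
  assumes "g \<in> carrier G" "w \<in> tangent_bundle M"
  shows "bundle_act \<mu> act M g w \<in> tangent_bundle M"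
  using assms measure_act_points pushforward_in_tangent_space(1)[OF manifold_M manifold_M measure_act_smooth]
  by (auto simp: tangent_bundle_def bundle_act_def)

text \<open>
  A score is the quotient of the derivative of the density by the density. Both correspond under
  \<open>g\<close> almost everywhere, hence so do the scores, with value \<open>0\<close> on both sides where \<open>p\<close> vanishes.
\<close>

lemma Phi_equivariant:
  assumes g: "g \<in> carrier G" and w: "w \<in> tangent_bundle M"
  shows "Phi \<mu> dens (bundle_act \<mu> act M g w) = L2_act \<mu> G act g (Phi \<mu> dens w)"
proof -
  obtain P v where wPv: "w = (P, v)" and P: "P \<in> points M" and v: "v \<in> tangent_space M P"
    using w by (auto simp: tangent_bundle_def)
  let ?Q = "measure_act \<mu> act g P" and ?u = "pushforward M (measure_act \<mu> act g) P v"
  have "wave ?Q ?u \<in> L2_fun \<mu>"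
    using bundle_act_tangent_bundle[OF g w] by (intro wave_L2) (auto simp: wPv bundle_act_def tangent_bundle_def)
  moreover have "(\<lambda>x. wave P v (act (inv g) x)) \<in> L2_fun \<mu>"
    by (rule L2_fun_compose[OF inv_act_preserves[OF g] wave_L2[OF P v]])
  moreover have "AE x in \<mu>. wave ?Q ?u x = wave P v (act (inv g) x)"
    using dens_measure_act[OF g P] density_deriv_pushforward[OF g P v]
    by eventually_elim (simp add: score_def)
  ultimately have "L2_class \<mu> (wave ?Q ?u) = L2_class \<mu> (\<lambda>x. wave P v (act (inv g) x))"
    by (simp add: L2_class_eq_iff)
  also have "\<dots> = L2_act \<mu> G act g (L2_class \<mu> (wave P v))"
    by (rule L2_act_class[OF g wave_L2[OF P v], symmetric])
  finally show ?thesis by (simp add: Phi_def bundle_act_def wPv)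
qed

end

theorem lemma4p1:
  fixes G :: "('g, 'z) monoid_scheme"
    and L :: "'g mfd"
    and X :: "'x mfd"
    and h :: "'x metric_field"
    and \<mu> :: "'x measure"
    and act :: "'g \<Rightarrow> 'x \<Rightarrow> 'x"
    and M :: "'x measure mfd"
    and dens :: "'x measure \<Rightarrow> 'x \<Rightarrow> real"
  assumes "statistical_transformation_model G L X h \<mu> act M dens"
  shows "(\<forall>g\<in>carrier G. PL2_act \<mu> G act g ` N_image \<mu> M dens \<subseteq> N_image \<mu> M dens) \<and>
    (\<forall>g\<in>carrier G. \<forall>w\<in>tangent_bundle M.
       (proj_class \<mu> \<circ> Phi \<mu> dens) (bundle_act \<mu> act M g w) =
       PL2_act \<mu> G act g ((proj_class \<mu> \<circ> Phi \<mu> dens) w))"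
proof -
  interpret statistical_transformation_model G L X h \<mu> act M dens by fact
  have equivariant: "(proj_class \<mu> \<circ> Phi \<mu> dens) (bundle_act \<mu> act M g w) =
      PL2_act \<mu> G act g ((proj_class \<mu> \<circ> Phi \<mu> dens) w)"
    if "g \<in> carrier G" "w \<in> tangent_bundle M" for g w
    using that Phi_mem[OF model] by (simp add: Phi_equivariant PL2_act_class)
  moreover have "PL2_act \<mu> G act g ` N_image \<mu> M dens \<subseteq> N_image \<mu> M dens" if g: "g \<in> carrier G" for g
  proof -
    have "PL2_act \<mu> G act g ((proj_class \<mu> \<circ> Phi \<mu> dens) w) \<in> N_image \<mu> M dens"
      if w: "w \<in> tangent_bundle M" for w
      unfolding N_image_def equivariant[OF g w, symmetric]
      by (intro imageI bundle_act_tangent_bundle[OF g w])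
    then show ?thesis unfolding N_image_def by blast
  qed
  ultimately show ?thesis by blast
qed

end
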